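(* Consider the $H$–ECF/CPG system on an element $\Omega$ with all quantities as in the context, and $U^{(o)}\ne0$. Let $$\widetilde K_H^{\mathrm{EC}}:=\frac{\widetilde C_H^{\mathrm{EC}}U^{(o)}(U^{(o)})^\top-U^{(o)}(U^{(o)})^\top\widetilde C_H^{\mathrm{EC}}}{\|U^{(o)}\|^2},\qquad \widetilde B_{H(G)}^{(o)}:=\widetilde B_H^{(o)}+\widetilde B_{H,\Delta}^{(o)},\qquad \widetilde{\mathcal Q}_{H(G)}^{(o)}:=\widetilde{\mathcal Q}_H^{(o)}+\widetilde B_{H,\Delta}^{(o)}U^{(o)},$$ and $E_\alpha:=\tfrac12\|U_\alpha^{(o)}\|_2^2$. Then for $\alpha=1,\dots,N_p$, $$\dot U^{(o)}_\alpha=-\sum_{\beta=1}^{N_p}\big(\widetilde N^{(o)}_{H,\mathrm{skw}}-\widetilde S_{\mathrm{skw}}-\widetilde K_H^{\mathrm{EC}}\big)_{\alpha\beta}U^{(o)}_\beta+\tfrac12\sum_{\beta=1}^{N_p}(\widetilde B_{H(G)}^{(o)})_{\alpha\beta}U^{(o)}_\beta-(\widetilde{\mathcal Q}_{H(G)}^{(o)})_\alpha,$$ $$\dot E_\alpha=\sum_{\beta=1}^{N_p}P^{\mathrm{EC}}_{\alpha\beta}+\tfrac12\sum_{\beta=1}^{N_p}(U^{(o)}_\alpha)^\top(\widetilde B_{H(G)}^{(o)})_{\alpha\beta}U^{(o)}_\beta-(U^{(o)}_\alpha)^\top(\widetilde{\mathcal Q}_{H(G)}^{(o)})_\alpha,$$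 where $P^{\mathrm{EC}}_{\alpha\beta}:=-(U^{(o)}_\alpha)^\top\big(\widetilde N^{(o)}_{H,\mathrm{skw}}-\widetilde S_{\mathrm{skw}}-\widetilde K_H^{\mathrm{EC}}\big)_{\alpha\beta}U^{(o)}_\beta$. Moreover $P^{\mathrm{EC}}_{\alpha\beta}=-P^{\mathrm{EC}}_{\beta\alpha}$ and $\sum_{\alpha,\beta=1}^{N_p}P^{\mathrm{EC}}_{\alpha\beta}=0$. Consequently $E:=\sum_{\alpha=1}^{N_p}E_\alpha$ satisfies $$\dot E=\tfrac12\sum_{\alpha,\beta=1}^{N_p}(U^{(o)}_\alpha)^\top(\widetilde B_{H(G)}^{(o)})_{\alpha\beta}U^{(o)}_\beta-\sum_{\alpha=1}^{N_p}(U^{(o)}_\alpha)^\top(\widetilde{\mathcal Q}_{H(G)}^{(o)})_\alpha .$$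
   Context: Physical setting. Repeated spatial indices $k$ are summed. The system is $\partial_tu+A_k(u)\partial_{x_k}u=0$, $u\in\mathbb R^m$ with values in an admissible set $\mathcal U$, $A_k=\partial_uF_k$. A smooth energy pair $(e,g_k)$ satisfies $\nabla_ue^\top A_k=\nabla_ug_k^\top$. On $\mathcal U$, $e>0$ and $\mathcal H_e=\nabla_u^2e$ is symmetric positive definite (SPD); $H(u)=\frac{2e(u)}{u^\top\mathcal H_e(u)u}\mathcal H_e(u)$, with eigenvalues in a fixed interval $[c_H,C_H]\subset(0,\infty)$. $G_k$ is a smooth symmetric matrix field with $g_k=\tfrac12u^\top G_ku$, and $G_k=H(A_k+\Delta A_k)$ defines $\Delta A_k$. Discrete setting. $\Omega\subset\mathbb R^d$ is an element with outward unit normal $n$, $V^p$ the polynomials of degree $\le p$, $N_p=\dim V^p$, $\{\phi_\alpha\}$ a time-independent $L^2$-orthonormal basis of $V^p$, $\Phi_\alpha=\phi_\alpha I_m$, $\Phi=[\Phi_1\cdots\Phi_{N_p}]$, and $u_p=\Phi U$ with $U(t)\in\mathbb R^{mN_p}$ (blocks $U_\alpha\in\mathbb R^m$). Matrices are $N_p\times N_p$ block matrices with $m\times m$ blocks, $X_{\mathrm{skw}}=\tfrac12(X-X^\top)$. $Q_{3p}$, $Q_{3p+1}^{\partial\Omega}$, $Q_{\mathrm{hi}(n)}$ ($n\ge3p+1$) are positive-weight quadratures (volume, face, volume) of exactness degrees $3p$, $3p+1$, $n$. For $X\in\{A,\Delta A\}$, $Y_{X,k,p+1}\in(V^{p+1})^{m\times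 m}$ is the componentwise discrete $L^2$ projection of $H(u_p)X_k(u_p)$ onto $V^{p+1}$ with quadrature $Q_{\mathrm{hi}(n)}$. CPG operators: $(\widetilde M_H)_{\alpha\beta}=Q_{3p}[\Phi_\alpha^\top H(u_p)\Phi_\beta]$ (SPD); $(\widetilde N_H)_{\alpha\beta}=Q_{3p}[\Phi_\alpha^\top Y_{A,k,p+1}\partial_{x_k}\Phi_\beta]$; $(\widetilde V_H)_{\alpha\beta}=Q_{3p}[\Phi_\alpha^\top(\partial_{x_k}Y_{A,k,p+1})\Phi_\beta]$; $(\widetilde B_H)_{\alpha\beta}=Q^{\partial\Omega}_{3p+1}[\Phi_\alpha^\top Y_{A,k,p+1}\Phi_\beta n_k]$; $(\widetilde B_{H,\Delta})_{\alpha\beta}=Q^{\partial\Omega}_{3p+1}[\Phi_\alpha^\top Y_{\Delta A,k,p+1}\Phi_\beta n_k]$; and $\dot{\widetilde M}_H=Q_{3p}[\Phi^\top D_uH(u_p)[\partial_tu_p]\Phi]$. The CPG equation is $\widetilde M_H\dot U+\widetilde N_HU=\widetilde B_HU-\widetilde{\mathcal Q}_H$, where $\widetilde{\mathcal Q}_H\in\mathbb R^{mN_p}$ is the boundary/interface numerical flux functional (an arbitrary given functional of interior and exterior traces). Orthogonalization. $\widetilde M_H=\widetilde R^\top\widetilde R$ with $\widetilde R$ upper triangular Cholesky; $U^{(o)}:=\widetilde RU$; $\widetilde X^{(o)}:=\widetilde R^{-\top}\widetilde X\widetilde R^{-1}$ for matrices; $\widetilde{\mathcal Q}_H^{(o)}:=\widetilde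 R^{-\top}\widetilde{\mathcal Q}_H$; $\widetilde S:=\dot{\widetilde R}\widetilde R^{-1}$. One has $\dot U^{(o)}=\widetilde R\dot U+\widetilde SU^{(o)}$ and $\widetilde S+\widetilde S^\top=\dot{\widetilde M}_H^{(o)}$, so the CPG equation reads $\dot U^{(o)}=(\widetilde S-\widetilde N_H^{(o)}+\widetilde B_H^{(o)})U^{(o)}-\widetilde{\mathcal Q}_H^{(o)}$. $H$–ECF closure. Let $\widetilde C_H:=\tfrac12(\dot{\widetilde M}_H^{(o)}+\widetilde V_H^{(o)}+\widetilde B_{H,\Delta}^{(o)})$, $\rho_H:=(U^{(o)})^\top\widetilde C_HU^{(o)}$, $\widetilde L_H:=\frac{\rho_H}{\|U^{(o)}\|^4}U^{(o)}(U^{(o)})^\top$, $\widetilde C_H^{\mathrm{EC}}:=\widetilde C_H-\widetilde L_H$. The $H$–ECF/CPG system is the orthogonalized CPG equation in which only the compatibility action $\widetilde C_HU^{(o)}$ is replaced by $\widetilde C_H^{\mathrm{EC}}U^{(o)}$, i.e. with $-\widetilde L_HU^{(o)}$ added to the right-hand side: $$\dot U^{(o)}=(\widetilde S-\widetilde N_H^{(o)}+\widetilde B_H^{(o)})U^{(o)}-\widetilde{\mathcal Q}_H^{(o)}-\widetilde L_HU^{(o)},$$ with $\widetilde M_H,\dot{\widetilde M}_H,\widetilde R,\widetilde S$ evaluated along the trajectory of this closed system. *)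

theory Defs
  imports "HOL-Analysis.Analysis"
begin

section \<open>Calculus\<close>

text \<open>On an open set \<open>S\<close> of a finite-dimensional space, \<open>Ck_on k S f\<close> is the usual
  class \<open>C\<^sup>k\<close>.\<close>

primrec Ck_on ::
  "nat \<Rightarrow> 'a::real_normed_vector set \<Rightarrow> ('a \<Rightarrow> 'b::real_normed_vector) \<Rightarrow> bool" where
  "Ck_on 0 S f \<longleftrightarrow> continuous_on S f"
| "Ck_on (Suc k) S f \<longleftrightarrow>
     f differentiable_on S \<and> (\<forall>v. Ck_on k S (\<lambda>x. frechet_derivative f (at x) v))"

definition smooth_on :: "'a::real_normed_vector set \<Rightarrow> ('a \<Rightarrow> 'b::real_normed_vector) \<Rightarrow> bool" where
  "smooth_on S f \<longleftrightarrow> (\<forall>k. Ck_on k S f)"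

definition pd :: "'d::finite \<Rightarrow> (real^'d \<Rightarrow> 'b::real_normed_vector) \<Rightarrow> real^'d \<Rightarrow> 'b" where
  "pd k f x = frechet_derivative f (at x) (axis k 1)"

definition grad :: "(real^'m \<Rightarrow> real) \<Rightarrow> real^'m \<Rightarrow> real^'m::finite" where
  "grad f u = (\<chi> i. pd i f u)"

definition hess :: "(real^'m \<Rightarrow> real) \<Rightarrow> real^'m \<Rightarrow> real^'m^'m::finite" where
  "hess f u = jacobian (grad f) (at u)"

section \<open>Matrices\<close>

definition sym_mat :: "real^'n^'n \<Rightarrow> bool" where
  "sym_mat X \<longleftrightarrow> transpose X = X"

definition spd :: "real^'n^'n \<Rightarrow> bool" where
  "spd X \<longleftrightarrow> sym_mat X \<and> (\<forall>v. v \<noteq> 0 \<longrightarrow> v \<bullet> (X *v v) > 0)"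

definition eigenvalue :: "real^'n^'n \<Rightarrow> real \<Rightarrow> bool" where
  "eigenvalue X l \<longleftrightarrow> (\<exists>v. v \<noteq> 0 \<and> X *v v = l *\<^sub>R v)"

definition skw :: "real^'n^'n \<Rightarrow> real^'n^'n" where
  "skw X = (1/2) *\<^sub>R (X - transpose X)"

definition outer :: "real^'n \<Rightarrow> real^'n \<Rightarrow> real^'n^'n" where
  "outer u v = (\<chi> i j. u $ i * v $ j)"

text \<open>Block vectors and block matrices with blocks of size \<open>m\<close> are indexed by pairs
  \<open>(\<alpha>, i)\<close>, where \<open>\<alpha>\<close> is the block index and \<open>i\<close> the index inside the block.\<close>

definition blockv :: "real^('n \<times> 'm) \<Rightarrow> 'n::finite \<Rightarrow> real^'m::finite" where
  "blockv U \<alpha> = (\<chi> i. U $ (\<alpha>, i))"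

definition block :: "real^('n \<times> 'm)^('n \<times> 'm) \<Rightarrow> 'n::finite \<Rightarrow> 'n \<Rightarrow> real^'m^'m::finite" where
  "block X \<alpha> \<beta> = (\<chi> i j. X $ (\<alpha>, i) $ (\<beta>, j))"

definition of_blocks ::
  "('n::finite \<Rightarrow> 'n \<Rightarrow> real^'m^'m::finite) \<Rightarrow> real^('n \<times> 'm)^('n \<times> 'm)" where
  "of_blocks B = (\<chi> a b. B (fst a) (fst b) $ snd a $ snd b)"

text \<open>The scalar unknowns are ordered block by block, that is, the index pairs are ordered
  lexicographically.  (The order is spelled out since HOL-Analysis already equips pairs with the
  componentwise order.)\<close>

definition upper_triangular ::
  "real^('n::{finite,linorder} \<times> 'm::{finite,linorder})^('n \<times> 'm) \<Rightarrow> bool" where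
  "upper_triangular R \<longleftrightarrow>
     (\<forall>\<alpha> i \<beta> j. \<beta> < \<alpha> \<or> (\<beta> = \<alpha> \<and> j < i) \<longrightarrow> R $ (\<alpha>, i) $ (\<beta>, j) = 0)"

definition cholesky_factor ::
  "real^('n::{finite,linorder} \<times> 'm::{finite,linorder})^('n \<times> 'm) \<Rightarrow> real^('n \<times> 'm)^('n \<times> 'm) \<Rightarrow> bool"
  where
  "cholesky_factor M R \<longleftrightarrow>
     upper_triangular R \<and> (\<forall>a. R $ a $ a > 0) \<and> M = transpose R ** R"

definition orth_mat :: "real^'n^'n \<Rightarrow> real^'n^'n \<Rightarrow> real^'n^'n" where
  "orth_mat R X = transpose (matrix_inv R) ** X ** matrix_inv R"

definition orth_vec :: "real^'n^'n \<Rightarrow> real^'n \<Rightarrow> real^'n" where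
  "orth_vec R q = transpose (matrix_inv R) *v q"

section \<open>Energy structure of the system of conservation laws\<close>

definition Hmat :: "(real^'m \<Rightarrow> real) \<Rightarrow> real^'m \<Rightarrow> real^'m^'m::finite" where
  "Hmat e u = (2 * e u / (u \<bullet> (hess e u *v u))) *\<^sub>R hess e u"

definition Amat :: "('d \<Rightarrow> real^'m \<Rightarrow> real^'m) \<Rightarrow> 'd \<Rightarrow> real^'m \<Rightarrow> real^'m^'m::finite" where
  "Amat F k u = jacobian (F k) (at u)"

text \<open>The last conjunct determines \<open>\<Delta>A\<^sub>k\<close> on the admissible set, because \<open>H\<close> is invertible
  there.\<close>

definition energy_structure ::
  "(real^'m) set \<Rightarrow> ('d \<Rightarrow> real^'m \<Rightarrow> real^'m) \<Rightarrow> (real^'m \<Rightarrow> real) \<Rightarrow> ('d \<Rightarrow> real^'m \<Rightarrow> real)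
    \<Rightarrow> ('d \<Rightarrow> real^'m \<Rightarrow> real^'m^'m) \<Rightarrow> ('d \<Rightarrow> real^'m \<Rightarrow> real^'m^'m::finite) \<Rightarrow> real \<Rightarrow> real \<Rightarrow> bool"
  where
  "energy_structure \<U> F e g G \<Delta>A cH CH \<longleftrightarrow>
     open \<U> \<and>
     (\<forall>k. F k differentiable_on \<U>) \<and>
     smooth_on \<U> e \<and> (\<forall>k. smooth_on \<U> (g k)) \<and>
     (\<forall>u\<in>\<U>. \<forall>k. grad e u v* Amat F k u = grad (g k) u) \<and>
     (\<forall>u\<in>\<U>. e u > 0 \<and> spd (hess e u)) \<and>
     0 < cH \<and> (\<forall>u\<in>\<U>. \<forall>l. eigenvalue (Hmat e u) l \<longrightarrow> cH \<le> l \<and> l \<le> CH) \<and>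
     (\<forall>k. smooth_on \<U> (G k)) \<and>
     (\<forall>u\<in>\<U>. \<forall>k. sym_mat (G k u) \<and> g k u = 1/2 * (u \<bullet> (G k u *v u))) \<and>
     (\<forall>u\<in>\<U>. \<forall>k. G k u = Hmat e u ** (Amat F k u + \<Delta>A k u))"

section \<open>Elements and face integrals\<close>

text \<open>A compact polyhedral domain, not necessarily convex: its boundary is a finite union of flat
  faces \<open>F\<close> which do not overlap, and \<open>\<nu> F\<close> is the outward unit normal on \<open>F\<close>.  Flatness makes
  the components of the normal constant on each face, so that a face quadrature of exactness degree
  \<open>r\<close> integrates polynomials of degree \<open>r\<close> times such a component exactly.\<close>

definition polyhedral_element ::
  "(real^'d) set \<Rightarrow> (real^'d) set set \<Rightarrow> ((real^'d) set \<Rightarrow> real^'d::finite) \<Rightarrow> bool" where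
  "polyhedral_element \<Omega> Fs \<nu> \<longleftrightarrow>
     compact \<Omega> \<and> interior \<Omega> \<noteq> {} \<and>
     finite Fs \<and> \<Union>Fs = frontier \<Omega> \<and>
     (\<forall>F\<in>Fs. polytope F \<and> aff_dim F = int CARD('d) - 1) \<and>
     (\<forall>F\<in>Fs. \<forall>F'\<in>Fs. F \<noteq> F' \<longrightarrow> rel_interior F \<inter> rel_interior F' = {}) \<and>
     (\<forall>F\<in>Fs. norm (\<nu> F) = 1 \<and> (\<forall>x\<in>F. \<forall>y\<in>F. \<nu> F \<bullet> (x - y) = 0)) \<and>
     (\<forall>F\<in>Fs. \<forall>x\<in>rel_interior F. \<exists>\<epsilon>>0. \<forall>s. 0 < s \<and> s < \<epsilon> \<longrightarrow>
        x - s *\<^sub>R \<nu> F \<in> \<Omega> \<and> x + s *\<^sub>R \<nu> F \<notin> \<Omega>)"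

text \<open>The integral over a flat face \<open>F\<close> with unit normal \<open>n\<close> with respect to
  \<open>(d-1)\<close>-dimensional surface measure.  The surface measure of a subset of \<open>F\<close> is the Lebesgue
  measure of the right prism of height one over it, so one integrates over the prism the
  function that is extended constantly in normal direction.\<close>

definition face_integral :: "(real^'d) set \<Rightarrow> real^'d \<Rightarrow> (real^'d \<Rightarrow> real) \<Rightarrow> real" where
  "face_integral F n f =
     (LINT y : {x + s *\<^sub>R n | x s. x \<in> F \<and> 0 \<le> s \<and> s \<le> 1} | lborel.
        f (closest_point (affine hull F) y))"

section \<open>Polynomials and quadratures\<close>

text \<open>\<open>V\<^sup>p\<close>: polynomial functions of total degree at most \<open>p\<close>.\<close>

definition Polys :: "nat \<Rightarrow> (real^'d::finite \<Rightarrow> real) set" where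
  "Polys p = {f. \<exists>c. f = (\<lambda>x. \<Sum>a | sum a UNIV \<le> p. c a * (\<Prod>k\<in>UNIV. x $ k ^ a k))}"

definition L2_orthonormal_basis ::
  "(real^'d) set \<Rightarrow> nat \<Rightarrow> ('n::finite \<Rightarrow> real^'d::finite \<Rightarrow> real) \<Rightarrow> bool" where
  "L2_orthonormal_basis \<Omega> p \<phi> \<longleftrightarrow>
     (\<forall>\<alpha>. \<phi> \<alpha> \<in> Polys p) \<and>
     (\<forall>f\<in>Polys p. \<exists>c. f = (\<lambda>x. \<Sum>\<alpha>\<in>UNIV. c \<alpha> * \<phi> \<alpha> x)) \<and>
     (\<forall>\<alpha> \<beta>. (LINT x:\<Omega>|lborel. \<phi> \<alpha> x * \<phi> \<beta> x) = (if \<alpha> = \<beta> then 1 else 0))"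

text \<open>A quadrature consists of its nodes and its weights.\<close>

type_synonym 'd quadrature = "(real^'d) set \<times> (real^'d \<Rightarrow> real)"

definition quad :: "'d quadrature \<Rightarrow> (real^'d \<Rightarrow> 'b::real_vector) \<Rightarrow> 'b" where
  "quad q f = (\<Sum>x\<in>fst q. snd q x *\<^sub>R f x)"

definition volume_quadrature :: "(real^'d::finite) set \<Rightarrow> nat \<Rightarrow> 'd quadrature \<Rightarrow> bool" where
  "volume_quadrature \<Omega> r q \<longleftrightarrow>
     finite (fst q) \<and> fst q \<subseteq> \<Omega> \<and> (\<forall>x\<in>fst q. snd q x > 0) \<and>
     (\<forall>f\<in>Polys r. quad q f = (LINT x:\<Omega>|lborel. f x))"

text \<open>A boundary quadrature is given face by face, because the normal is discontinuous across the
  edges.\<close>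

definition face_quadrature ::
  "(real^'d::finite) set set \<Rightarrow> ((real^'d) set \<Rightarrow> real^'d) \<Rightarrow> nat \<Rightarrow> ((real^'d) set \<Rightarrow> 'd quadrature) \<Rightarrow> bool"
  where
  "face_quadrature Fs \<nu> r qF \<longleftrightarrow>
     (\<forall>F\<in>Fs. finite (fst (qF F)) \<and> fst (qF F) \<subseteq> F \<and> (\<forall>x\<in>fst (qF F). snd (qF F) x > 0) \<and>
        (\<forall>f\<in>Polys r. quad (qF F) f = face_integral F (\<nu> F) f))"

text \<open>The integrand of a boundary quadrature may depend on the outward normal.\<close>

definition bquad ::
  "(real^'d) set set \<Rightarrow> ((real^'d) set \<Rightarrow> real^'d) \<Rightarrow> ((real^'d) set \<Rightarrow> 'd quadrature)
    \<Rightarrow> (real^'d \<Rightarrow> real^'d \<Rightarrow> 'b::real_vector) \<Rightarrow> 'b" where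
  "bquad Fs \<nu> qF f = (\<Sum>F\<in>Fs. quad (qF F) (\<lambda>x. f x (\<nu> F)))"

text \<open>If the quadrature is exact of degree at least \<open>2 r\<close> on an element, the discrete
  \<open>L\<^sup>2\<close> projection is unique.  In general it exists and one of the discrete best approximations is
  chosen, depending only on the values of \<open>f\<close> at the nodes.\<close>

definition disc_proj ::
  "'d::finite quadrature \<Rightarrow> nat \<Rightarrow> (real^'d \<Rightarrow> real) \<Rightarrow> real^'d \<Rightarrow> real" where
  "disc_proj q r f = (SOME v. v \<in> Polys r \<and>
     (\<forall>w\<in>Polys r. quad q (\<lambda>x. v x * w x) = quad q (\<lambda>x. f x * w x)))"

section \<open>CPG operators\<close>

definition Phi :: "('n \<Rightarrow> real^'d \<Rightarrow> real) \<Rightarrow> 'n \<Rightarrow> real^'d \<Rightarrow> real^'m^'m::finite" where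
  "Phi \<phi> \<alpha> x = \<phi> \<alpha> x *\<^sub>R mat 1"

definition state ::
  "('n::finite \<Rightarrow> real^'d \<Rightarrow> real) \<Rightarrow> real^('n \<times> 'm) \<Rightarrow> real^'d \<Rightarrow> real^'m::finite" where
  "state \<phi> U x = (\<Sum>\<alpha>\<in>UNIV. Phi \<phi> \<alpha> x *v blockv U \<alpha>)"

definition Yproj ::
  "(real^'m \<Rightarrow> real) \<Rightarrow> 'd quadrature \<Rightarrow> nat \<Rightarrow> ('d \<Rightarrow> real^'m \<Rightarrow> real^'m^'m) \<Rightarrow> (real^'d \<Rightarrow> real^'m)
    \<Rightarrow> 'd::finite \<Rightarrow> real^'d \<Rightarrow> real^'m^'m::finite" where
  "Yproj e q r X u k x = (\<chi> i j. disc_proj q r (\<lambda>z. (Hmat e (u z) ** X k (u z)) $ i $ j) x)"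

definition mass_op ::
  "(real^'m \<Rightarrow> real) \<Rightarrow> ('n::finite \<Rightarrow> real^'d \<Rightarrow> real) \<Rightarrow> 'd quadrature \<Rightarrow> (real^'d \<Rightarrow> real^'m)
    \<Rightarrow> real^('n \<times> 'm)^('n \<times> 'm::finite)" where
  "mass_op e \<phi> q u = of_blocks (\<lambda>\<alpha> \<beta>.
     quad q (\<lambda>x. transpose (Phi \<phi> \<alpha> x) ** Hmat e (u x) ** Phi \<phi> \<beta> x))"

text \<open>Here \<open>ut\<close> is the time derivative of the state \<open>u\<close>.\<close>

definition mass_dot_op ::
  "(real^'m \<Rightarrow> real) \<Rightarrow> ('n::finite \<Rightarrow> real^'d \<Rightarrow> real) \<Rightarrow> 'd quadrature \<Rightarrow> (real^'d \<Rightarrow> real^'m)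
    \<Rightarrow> (real^'d \<Rightarrow> real^'m) \<Rightarrow> real^('n \<times> 'm)^('n \<times> 'm::finite)" where
  "mass_dot_op e \<phi> q u ut = of_blocks (\<lambda>\<alpha> \<beta>.
     quad q (\<lambda>x. transpose (Phi \<phi> \<alpha> x) ** frechet_derivative (Hmat e) (at (u x)) (ut x)
       ** Phi \<phi> \<beta> x))"

definition adv_op ::
  "('n::finite \<Rightarrow> real^'d \<Rightarrow> real) \<Rightarrow> 'd quadrature \<Rightarrow> ('d::finite \<Rightarrow> real^'d \<Rightarrow> real^'m^'m)
    \<Rightarrow> real^('n \<times> 'm)^('n \<times> 'm::finite)" where
  "adv_op \<phi> q Y = of_blocks (\<lambda>\<alpha> \<beta>.
     quad q (\<lambda>x. \<Sum>k\<in>UNIV. transpose (Phi \<phi> \<alpha> x) ** Y k x ** pd k (Phi \<phi> \<beta>) x))"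

definition div_op ::
  "('n::finite \<Rightarrow> real^'d \<Rightarrow> real) \<Rightarrow> 'd quadrature \<Rightarrow> ('d::finite \<Rightarrow> real^'d \<Rightarrow> real^'m^'m)
    \<Rightarrow> real^('n \<times> 'm)^('n \<times> 'm::finite)" where
  "div_op \<phi> q Y = of_blocks (\<lambda>\<alpha> \<beta>.
     quad q (\<lambda>x. \<Sum>k\<in>UNIV. transpose (Phi \<phi> \<alpha> x) ** pd k (Y k) x ** Phi \<phi> \<beta> x))"

definition bdry_op ::
  "('n::finite \<Rightarrow> real^'d \<Rightarrow> real) \<Rightarrow> (real^'d) set set \<Rightarrow> ((real^'d) set \<Rightarrow> real^'d)
    \<Rightarrow> ((real^'d) set \<Rightarrow> 'd quadrature) \<Rightarrow> ('d::finite \<Rightarrow> real^'d \<Rightarrow> real^'m^'m)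
    \<Rightarrow> real^('n \<times> 'm)^('n \<times> 'm::finite)" where
  "bdry_op \<phi> Fs \<nu> qF Y = of_blocks (\<lambda>\<alpha> \<beta>.
     bquad Fs \<nu> qF (\<lambda>x n. \<Sum>k\<in>UNIV. n $ k *\<^sub>R (transpose (Phi \<phi> \<alpha> x) ** Y k x ** Phi \<phi> \<beta> x)))"

end

theory Submission
  imports Defs
begin

text \<open>
  Everything rests on two facts about the orthogonalized operators along the trajectory,
  \<open>N + N\<^sup>T + V = B\<close> and \<open>S + S\<^sup>T = M'\<close>, where \<open>M'\<close> is the transformed time derivative of the mass
  matrix.  They identify the symmetric part of \<open>S - N + B\<close> as \<open>1/2 (M' + V + B)\<close>.  Adding and
  subtracting \<open>1/2 B\<^sub>\<Delta>\<close> turns this into the compatibility matrix \<open>C\<close> plus boundary terms, so what is left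
  besides skew parts and boundary terms is \<open>(C - L) u\<close>.  The matrix \<open>L\<close> is chosen so that \<open>(C - L) u\<close>
  is orthogonal to \<open>u\<close>.  A vector \<open>w = X u\<close> orthogonal to \<open>u\<close> is also the image of \<open>u\<close> under the
  rank-two matrix \<open>(X u u\<^sup>T - u u\<^sup>T X) / |u|\<^sup>2\<close>, which is skew when \<open>X\<close> is symmetric
  (\<open>skew_form_of_closed_system\<close>, \<open>rank_two_skew_transpose\<close>).  Skewness makes the pairwise energy
  transfers antisymmetric, so they cancel in the total energy.

  The identity \<open>N + N\<^sup>T + V = B\<close> (\<open>summation_by_parts\<close>) needs three ingredients.  The matrices \<open>Y\<close> must
  be symmetric; they must be polynomials of degree \<open>p + 1\<close>, so that the degrees of all integrands lie
  within the exactness of the quadratures; and polynomials must satisfy the divergence theorem on the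
  polyhedral element.

  \<^item> Symmetry: \<open>\<psi> = \<nabla>e \<bullet> F - g\<close> has gradient \<open>(Hess e) F\<close> because of the compatibility
    \<open>\<nabla>e\<^sup>T A = \<nabla>g\<^sup>T\<close>.  Symmetry of the second derivatives of \<open>\<psi>\<close> and of the third derivatives of \<open>e\<close>
    makes \<open>(Hess e) A\<close> symmetric (\<open>hess_flux_symmetric\<close>).  Only differentiability of \<open>F\<close> is assumed, so
    the theorem on mixed derivatives is proved for functions that are twice differentiable without
    continuity of the second derivative (\<open>second_derivative_symmetric\<close>).

  \<^item> Polynomials: the discrete projection exists for every quadrature with positive weights, by the
    Gram-Schmidt argument applied to the monomials (\<open>disc_proj_in_Polys\<close>).

  \<^item> Divergence theorem (\<open>polyhedral_divergence\<close>): Lebesgue measure is disintegrated into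
    lines of a fixed direction \<open>v\<close>.  Almost every line meets the faces only transversally and in relative
    interior points, where it enters or leaves the element according to the sign of the normal component.
    On such a line the fundamental theorem of calculus gives the signed sum of the values at the crossing
    points, and integrating the contribution of one face over all lines gives \<open>\<bar>\<nu> \<bullet> v\<bar>\<close> times its surface
    integral.

  The identity \<open>S + S\<^sup>T = M'\<close> follows by differentiating \<open>M = R\<^sup>T R\<close>, once \<open>R\<close> is known to be
  differentiable.  Its entries are obtained from those of \<open>M\<close> by the explicit Cholesky recursion, which
  only involves differentiable operations (\<open>factor_differentiable\<close>).
\<close>

section \<open>Averaging over parallel lines\<close>

text \<open>Every point \<open>z\<close> lies on exactly one line of direction \<open>v\<close>, and that line spends unit time in the slab
  \<open>0 \<le> a \<bullet> y - c \<le> 1\<close>.  Choosing the base point \<open>y\<close> in this slab with Lebesgue measure therefore counts every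
  \<open>z\<close> with total weight one.  The argument is Tonelli and translation invariance, so no change of
  variables by a linear map is involved.\<close>

lemma nn_integral_line_average:
  fixes a v :: "'a::euclidean_space" and g :: "'a \<Rightarrow> ennreal"
  assumes av: "a \<bullet> v = 1" and [measurable]: "g \<in> borel_measurable borel"
  shows "(\<integral>\<^sup>+z. g z \<partial>lborel) =
    (\<integral>\<^sup>+y. indicator {0..1} (a \<bullet> y - c) * (\<integral>\<^sup>+s. g (y + s *\<^sub>R v) \<partial>lborel) \<partial>lborel)"
proof -
  have "(\<integral>\<^sup>+y. indicator {0..1} (a \<bullet> y - c) * (\<integral>\<^sup>+s. g (y + s *\<^sub>R v) \<partial>lborel) \<partial>lborel)
      = (\<integral>\<^sup>+y. (\<integral>\<^sup>+s. indicator {0..1} (a \<bullet> y - c) * g (y + s *\<^sub>R v) \<partial>lborel) \<partial>lborel)"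
    by (intro nn_integral_cong nn_integral_cmult[symmetric]) measurable
  also have "\<dots> = (\<integral>\<^sup>+s. (\<integral>\<^sup>+y. indicator {0..1} (a \<bullet> y - c) * g (y + s *\<^sub>R v) \<partial>lborel) \<partial>lborel)"
    by (rule lborel_pair.Fubini'[symmetric]) measurable
  also have "\<dots> = (\<integral>\<^sup>+s. (\<integral>\<^sup>+z. indicator {0..1} (a \<bullet> z - s - c) * g z \<partial>lborel) \<partial>lborel)"
  proof (rule nn_integral_cong)
    fix s :: real
    have "(\<integral>\<^sup>+z. indicator {0..1} (a \<bullet> z - s - c) * g z \<partial>lborel)
        = (\<integral>\<^sup>+z. indicator {0..1} (a \<bullet> z - s - c) * g z \<partial>distr lborel borel ((+) (s *\<^sub>R v)))"
      by (simp add: lborel_distr_plus)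
    also have "\<dots> = (\<integral>\<^sup>+y. indicator {0..1} (a \<bullet> (s *\<^sub>R v + y) - s - c) * g (s *\<^sub>R v + y) \<partial>lborel)"
      by (subst nn_integral_distr) auto
    finally show "(\<integral>\<^sup>+y. indicator {0..1} (a \<bullet> y - c) * g (y + s *\<^sub>R v) \<partial>lborel)
        = (\<integral>\<^sup>+z. indicator {0..1} (a \<bullet> z - s - c) * g z \<partial>lborel)"
      using av by (simp add: inner_add_right add.commute)
  qed
  also have "\<dots> = (\<integral>\<^sup>+z. (\<integral>\<^sup>+s. indicator {0..1} (a \<bullet> z - s - c) * g z \<partial>lborel) \<partial>lborel)"
    by (rule lborel_pair.Fubini') measurable
  also have "\<dots> = (\<integral>\<^sup>+z. g z \<partial>lborel)"
  proof (rule nn_integral_cong)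
    fix z :: 'a
    have "(\<integral>\<^sup>+s. indicator {0..1} (a \<bullet> z - s - c) * g z \<partial>lborel)
        = (\<integral>\<^sup>+s. indicator {a \<bullet> z - c - 1..a \<bullet> z - c} s * g z \<partial>lborel)"
      by (intro nn_integral_cong) (auto simp: indicator_def)
    also have "\<dots> = g z"
      by (subst nn_integral_multc) auto
    finally show "(\<integral>\<^sup>+s. indicator {0..1} (a \<bullet> z - s - c) * g z \<partial>lborel) = g z" .
  qed
  finally show ?thesis by simp
qed

text \<open>The averaging formula as an equality of measures, from which it carries over to signed integrands.\<close>

lemma lborel_eq_distr_lines:
  fixes a v :: "'a::euclidean_space"
  assumes "a \<bullet> v = 1"
  shows "distr (density (lborel \<Otimes>\<^sub>M lborel) (\<lambda>(y, s). ennreal (indicator {0..1} (a \<bullet> y - c))))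
    borel (\<lambda>(y, s::real). y + s *\<^sub>R v) = lborel" (is "?L = _")
proof (rule measure_eqI)
  fix A assume "A \<in> sets ?L"
  then have A[measurable]: "A \<in> sets borel" by simp
  have "emeasure ?L A = (\<integral>\<^sup>+z. indicator A z \<partial>?L)"
    by simp
  also have "\<dots> = (\<integral>\<^sup>+p. (case p of (y, s) \<Rightarrow> ennreal (indicator {0..1} (a \<bullet> y - c)))
      * indicator A (case p of (y, s) \<Rightarrow> y + s *\<^sub>R v) \<partial>(lborel \<Otimes>\<^sub>M lborel))"
    by (subst nn_integral_distr, simp, simp, subst nn_integral_density) auto
  also have "\<dots> = (\<integral>\<^sup>+y. (\<integral>\<^sup>+s. indicator {0..1} (a \<bullet> y - c) * indicator A (y + s *\<^sub>R v) \<partial>lborel) \<partial>lborel)"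
    by (subst lborel.nn_integral_fst[symmetric]) (auto simp: ennreal_indicator)
  also have "\<dots> = (\<integral>\<^sup>+y. indicator {0..1} (a \<bullet> y - c) * (\<integral>\<^sup>+s. indicator A (y + s *\<^sub>R v) \<partial>lborel) \<partial>lborel)"
    by (intro nn_integral_cong nn_integral_cmult) measurable
  also have "\<dots> = (\<integral>\<^sup>+z. indicator A z \<partial>lborel)"
    by (rule nn_integral_line_average[symmetric, OF assms]) measurable
  finally show "emeasure ?L A = emeasure lborel A" by simp
qed simp

lemma
  fixes a v :: "'a::euclidean_space" and g :: "'a \<Rightarrow> real"
  assumes av: "a \<bullet> v = 1" and g: "integrable lborel g"
  shows integrable_line_average:
      "integrable lborel (\<lambda>y. indicator {0..1} (a \<bullet> y - c) * (\<integral>s. g (y + s *\<^sub>R v) \<partial>lborel))"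
    and integral_line_average:
      "integral\<^sup>L lborel g =
        (\<integral>y. indicator {0..1} (a \<bullet> y - c) * (\<integral>s. g (y + s *\<^sub>R v) \<partial>lborel) \<partial>lborel)"
proof -
  \<comment> \<open>\<open>lborel\<close> is the image under \<open>?T\<close> of the product measure with density \<open>?w\<close>\<close>
  let ?w = "\<lambda>(y, s::real). indicator {0..1} (a \<bullet> y - c) :: real"
  let ?T = "\<lambda>(y, s). y + s *\<^sub>R v"
  let ?P = "lborel \<Otimes>\<^sub>M lborel :: ('a \<times> real) measure"
  have [measurable]: "g \<in> borel_measurable borel"
    using g borel_measurable_integrable by auto
  have [measurable]: "?w \<in> borel_measurable ?P" "?T \<in> measurable ?P borel"
    by measurable
  have D: "distr (density ?P (\<lambda>p. ennreal (?w p))) borel ?T = lborel"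
    using lborel_eq_distr_lines[OF av, of c] by (simp add: case_prod_unfold)
  have "integrable (density ?P (\<lambda>p. ennreal (?w p))) (\<lambda>p. g (?T p))"
    using g by (subst (asm) D[symmetric], subst (asm) integrable_distr_eq) simp_all
  then have int: "integrable ?P (\<lambda>p. ?w p * g (?T p))"
    by (subst (asm) integrable_density) (auto simp: case_prod_unfold)
  show "integrable lborel (\<lambda>y. indicator {0..1} (a \<bullet> y - c) * (\<integral>s. g (y + s *\<^sub>R v) \<partial>lborel))"
    using lborel_pair.integrable_fst'[OF int] by simp
  have "integral\<^sup>L lborel g = integral\<^sup>L (density ?P (\<lambda>p. ennreal (?w p))) (\<lambda>p. g (?T p))"
    by (subst D[symmetric], subst integral_distr) simp_all
  also have "\<dots> = integral\<^sup>L ?P (\<lambda>p. ?w p * g (?T p))"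
    by (subst integral_density) (auto simp: case_prod_unfold)
  also have "\<dots> = (\<integral>y. (\<integral>s. ?w (y, s) * g (?T (y, s)) \<partial>lborel) \<partial>lborel)"
    using lborel_pair.integral_fst'[OF int] by simp
  finally show "integral\<^sup>L lborel g =
      (\<integral>y. indicator {0..1} (a \<bullet> y - c) * (\<integral>s. g (y + s *\<^sub>R v) \<partial>lborel) \<partial>lborel)"
    by simp
qed

text \<open>A shear moves every line of direction \<open>w\<close> along itself by a constant, because \<open>a \<bullet> z\<close> does not vary
  along \<open>w\<close>; hence the averages over these lines do not change.\<close>

lemma lborel_distr_shear:
  fixes a w :: "'a::euclidean_space"
  assumes "a \<bullet> w = 0"
  shows "distr lborel borel (\<lambda>z. z + (a \<bullet> z - c) *\<^sub>R w) = lborel"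
proof (cases "w = 0")
  case True
  then show ?thesis by (simp add: distr_id2)
next
  case False
  define b where "b = (1 / (w \<bullet> w)) *\<^sub>R w"
  have bw: "b \<bullet> w = 1" using False by (simp add: b_def)
  let ?T = "\<lambda>z. z + (a \<bullet> z - c) *\<^sub>R w"
  show ?thesis
  proof (rule measure_eqI)
    fix A assume "A \<in> sets (distr lborel borel ?T)"
    then have A[measurable]: "A \<in> sets borel" by simp
    have "emeasure (distr lborel borel ?T) A = (\<integral>\<^sup>+z. indicator A z \<partial>distr lborel borel ?T)"
      by simp
    also have "\<dots> = (\<integral>\<^sup>+z. indicator A (?T z) \<partial>lborel)"
      by (subst nn_integral_distr) measurable
    also have "\<dots> = (\<integral>\<^sup>+y. indicator {0..1} (b \<bullet> y - 0) * (\<integral>\<^sup>+s. indicator A (?T (y + s *\<^sub>R w)) \<partial>lborel) \<partial>lborel)"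
      by (rule nn_integral_line_average[OF bw]) measurable
    also have "\<dots> = (\<integral>\<^sup>+y. indicator {0..1} (b \<bullet> y - 0) * (\<integral>\<^sup>+s. indicator A (y + s *\<^sub>R w) \<partial>lborel) \<partial>lborel)"
    proof (rule nn_integral_cong)
      fix y :: 'a
      let ?t = "a \<bullet> y - c"
      have "(\<integral>\<^sup>+s. indicator A (y + s *\<^sub>R w) \<partial>lborel)
          = (\<integral>\<^sup>+s. indicator A (y + s *\<^sub>R w) \<partial>distr lborel borel ((+) ?t))"
        by (simp add: lborel_distr_plus)
      also have "\<dots> = (\<integral>\<^sup>+s. indicator A (y + (?t + s) *\<^sub>R w) \<partial>lborel)"
        by (subst nn_integral_distr) measurable
      finally have "(\<integral>\<^sup>+s. indicator A (?T (y + s *\<^sub>R w)) \<partial>lborel)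
          = (\<integral>\<^sup>+s. indicator A (y + s *\<^sub>R w) \<partial>lborel)"
        using assms by (simp add: inner_add_right scaleR_left_distrib ac_simps)
      then show "indicator {0..1} (b \<bullet> y - 0) * (\<integral>\<^sup>+s. indicator A (?T (y + s *\<^sub>R w)) \<partial>lborel)
          = indicator {0..1} (b \<bullet> y - 0) * (\<integral>\<^sup>+s. indicator A (y + s *\<^sub>R w) \<partial>lborel)"
        by simp
    qed
    also have "\<dots> = (\<integral>\<^sup>+z. indicator A z \<partial>lborel)"
      by (rule nn_integral_line_average[symmetric, OF bw]) measurable
    finally show "emeasure (distr lborel borel ?T) A = emeasure lborel A" by simp
  qed simp
qed

section \<open>Integration of a derivative over a compact set of reals\<close>

text \<open>Ray casting: the points \<open>p i\<close> are the candidates for boundary points of \<open>J\<close>, with sign \<open>1\<close> where \<open>J\<close> is left and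
  \<open>-1\<close> where it is entered in increasing direction.  The induction moves \<open>r\<close> to the left, across the
  largest \<open>p i\<close> below \<open>r\<close>.\<close>

lemma signed_crossings_count:
  fixes J :: "real set" and p :: "'i \<Rightarrow> real" and \<sigma> :: "'i \<Rightarrow> real"
  assumes J: "bounded J" and I: "finite I" "inj_on p I"
    and fr: "frontier J \<subseteq> p ` I"
    and \<sigma>: "\<And>i. i \<in> I \<Longrightarrow> \<sigma> i = 1 \<or> \<sigma> i = -1"
    and cross: "\<And>i. i \<in> I \<Longrightarrow> \<exists>\<delta>>0. \<forall>t. 0 < t \<and> t < \<delta> \<longrightarrow>
                  p i - \<sigma> i * t \<in> J \<and> p i + \<sigma> i * t \<notin> J"
    and r: "r \<notin> p ` I"
  shows "indicator J r = - (\<Sum>i | i \<in> I \<and> p i < r. \<sigma> i)"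
  using r
proof (induction "card {i \<in> I. p i < r}" arbitrary: r rule: less_induct)
  case less
  have same: "(x \<in> J) = (y \<in> J)"
    if "x \<le> y" "{x..y} \<inter> p ` I = {}" for x y
  proof -
    have "{x..y} \<inter> frontier J = {}" using that fr by blast
    then have "{x..y} \<inter> J = {} \<or> {x..y} - J = {}"
      using connected_Int_frontier[of "{x..y}" J] by auto
    then show ?thesis using that(1) by auto
  qed
  show ?case
  proof (cases "{i \<in> I. p i < r} = {}")
    case True
    from J obtain b where b: "\<And>x. x \<in> J \<Longrightarrow> \<bar>x\<bar> \<le> b"
      by (auto simp: bounded_iff)
    define x where "x = min r (- b - 1)"
    have "x \<notin> J" using b[of x] by (auto simp: x_def)
    moreover have "{x..r} \<inter> p ` I = {}" using True less.prems by force
    ultimately have "r \<notin> J" using same[of x r] by (auto simp: x_def)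
    then show ?thesis by (simp add: True)
  next
    case False
    let ?A = "{i \<in> I. p i < r}"
    have finA: "finite ?A" using I by simp
    define m where "m = Max (p ` ?A)"
    have "m \<in> p ` ?A" unfolding m_def using finA False by (intro Max_in) auto
    then obtain i where i: "i \<in> I" "p i < r" "p i = m" by auto
    have le: "p j \<le> m" if "j \<in> I" "p j < r" for j
      unfolding m_def using finA that by (intro Max_ge) auto
    have lt: "p j < m" if "j \<in> I" "p j < r" "j \<noteq> i" for j
      using le[of j] that i I(2) by (force simp: inj_on_def)
    obtain \<delta> where \<delta>: "\<delta> > 0"
      "\<And>t. 0 < t \<Longrightarrow> t < \<delta> \<Longrightarrow> m - \<sigma> i * t \<in> J \<and> m + \<sigma> i * t \<notin> J"
      using cross[OF i(1)] i(3) by auto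
    have "\<exists>t>0. t < \<delta> \<and> m + t < r \<and> (\<forall>j\<in>?A - {i}. p j < m - t)"
    proof (cases "?A - {i} = {}")
      case True
      then show ?thesis
        using \<delta>(1) i by (intro exI[of _ "min \<delta> (r - m) / 2"]) (auto simp: min_def field_simps)
    next
      case False
      define k where "k = Max (p ` (?A - {i}))"
      have "k \<in> p ` (?A - {i})" unfolding k_def using finA False by (intro Max_in) auto
      then have "k < m" using lt by auto
      moreover have kle: "p j \<le> k" if "j \<in> ?A - {i}" for j
        unfolding k_def using finA that by (intro Max_ge) auto
      moreover define e where "e = min \<delta> (min (r - m) (m - k))"
      ultimately have "e > 0" "e \<le> \<delta>" "e \<le> r - m" "e \<le> m - k"
        using \<delta>(1) i by (simp_all add: e_def)
      moreover define t where "t = e / 2"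
      ultimately have "t > 0" "t < \<delta>" "m + t < r" "k < m - t"
        by simp_all
      then show ?thesis
        using kle by (intro exI[of _ t]) force
    qed
    then obtain t where t: "t > 0" "t < \<delta>" "m + t < r" "\<And>j. j \<in> ?A - {i} \<Longrightarrow> p j < m - t"
      by auto
    have A': "{j \<in> I. p j < m - t} = ?A - {i}"
      using t i by force
    have "m - t \<notin> p ` I"
      using t(1,3,4) i by force
    moreover have "card {j \<in> I. p j < m - t} < card ?A"
      unfolding A' using finA i by (intro psubset_card_mono) auto
    ultimately have IH: "indicator J (m - t) = - (\<Sum>j\<in>?A - {i}. \<sigma> j)"
      using less.hyps[of "m - t"] A' by simp
    have "{m + t..r} \<inter> p ` I = {}"
      using le t(1) less.prems by (force simp: not_less)
    then have "(m + t \<in> J) = (r \<in> J)"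
      using same[of "m + t" r] t(3) by simp
    moreover have "(\<Sum>j\<in>?A. \<sigma> j) = \<sigma> i + (\<Sum>j\<in>?A - {i}. \<sigma> j)"
      using finA i by (intro sum.remove) auto
    ultimately show ?thesis
      using IH \<delta>(2)[OF t(1,2)] \<sigma>[OF i(1)] by (auto simp: indicator_def)
  qed
qed

text \<open>By the ray casting formula the indicator of \<open>J\<close> is a signed sum of indicators of half lines starting
  at the crossings, and the fundamental theorem applies to each of them.  The contributions of the common
  right end point cancel because the signs add up to zero.\<close>

lemma integral_deriv_signed_crossings:
  fixes J :: "real set" and p :: "'i \<Rightarrow> real" and \<sigma> :: "'i \<Rightarrow> real" and h h' :: "real \<Rightarrow> real"
  assumes J: "compact J" and I: "finite I" "inj_on p I"
    and fr: "frontier J \<subseteq> p ` I"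
    and \<sigma>: "\<And>i. i \<in> I \<Longrightarrow> \<sigma> i = 1 \<or> \<sigma> i = -1"
    and cross: "\<And>i. i \<in> I \<Longrightarrow> \<exists>\<delta>>0. \<forall>t. 0 < t \<and> t < \<delta> \<longrightarrow>
                  p i - \<sigma> i * t \<in> J \<and> p i + \<sigma> i * t \<notin> J"
    and h: "\<And>x. (h has_real_derivative h' x) (at x)" and h': "continuous_on UNIV h'"
  shows "(\<integral>s. indicator J s * h' s \<partial>lborel) = (\<Sum>i\<in>I. \<sigma> i * h (p i))"
proof -
  have bJ: "bounded J" using J compact_imp_bounded by blast
  have count: "indicator J r = - (\<Sum>i | i \<in> I \<and> p i < r. \<sigma> i)" if "r \<notin> p ` I" for r
    by (rule signed_crossings_count[OF bJ I fr \<sigma> cross that])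
  have "bounded (J \<union> p ` I)" using bJ I finite_imp_bounded[of "p ` I"] by simp
  then obtain B where B: "\<And>x. x \<in> J \<union> p ` I \<Longrightarrow> \<bar>x\<bar> \<le> B"
    by (auto simp: bounded_iff)
  \<comment> \<open>a common right end point beyond \<open>J\<close> and all crossings, used in place of infinity\<close>
  define b where "b = \<bar>B\<bar> + 1"
  have b: "- b < x" "x < b" if "x \<in> J \<union> p ` I" for x
    using B[OF that] by (auto simp: b_def)
  have "b \<notin> J \<union> p ` I" using b[of b] by auto
  moreover have "{i \<in> I. p i < b} = I" using b by auto
  ultimately have total: "(\<Sum>i\<in>I. \<sigma> i) = 0"
    using count[of b] by auto
  have int: "set_integrable lborel {c..b} h'" for c
    using h' by (intro borel_integrable_compact[folded set_integrable_def])
      (auto intro: continuous_on_subset)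
  have ftc: "(\<integral>s. indicator {p i..b} s * h' s \<partial>lborel) = h b - h (p i)" if "i \<in> I" for i
    using b[of "p i"] that h h'
    by (subst integral_FTC_Icc_real[of _ _ h h', symmetric])
       (auto simp: mult.commute continuous_on_eq_continuous_at)
  have "AE s in lborel. s \<notin> p ` I"
    using I by (intro AE_not_in finite_imp_null_set_lborel) auto
  then have "AE s in lborel. indicator J s * h' s = (\<Sum>i\<in>I. - \<sigma> i * (indicator {p i..b} s * h' s))"
  proof eventually_elim
    case (elim s)
    show ?case
    proof (cases "s \<le> b")
      case True
      have "(\<Sum>i\<in>I. - \<sigma> i * (indicator {p i..b} s * h' s))
          = (\<Sum>i\<in>I. if p i < s then - \<sigma> i * h' s else 0)"
        using elim True by (intro sum.cong) (auto simp: indicator_def)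
      also have "\<dots> = - (\<Sum>i | i \<in> I \<and> p i < s. \<sigma> i) * h' s"
        using I by (simp add: sum.inter_filter[symmetric] sum_distrib_right sum_negf)
      finally show ?thesis using count[OF elim] by simp
    next
      case False
      then have "s \<notin> J" using b[of s] by auto
      then show ?thesis using False by simp
    qed
  qed
  then have "(\<integral>s. indicator J s * h' s \<partial>lborel)
      = (\<integral>s. (\<Sum>i\<in>I. - \<sigma> i * (indicator {p i..b} s * h' s)) \<partial>lborel)"
  proof (rule integral_cong_AE[rotated 2])
    have [measurable]: "h' \<in> borel_measurable borel" "J \<in> sets borel"
      using h' J by (auto intro: borel_measurable_continuous_onI borel_compact)
    show "(\<lambda>s. indicator J s * h' s) \<in> borel_measurable lborel"
      "(\<lambda>s. (\<Sum>i\<in>I. - \<sigma> i * (indicator {p i..b} s * h' s))) \<in> borel_measurable lborel"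
      by measurable
  qed
  also have "\<dots> = (\<Sum>i\<in>I. - \<sigma> i * (h b - h (p i)))"
    using int ftc by (subst Bochner_Integration.integral_sum) (auto simp: set_integrable_def)
  also have "\<dots> = (\<Sum>i\<in>I. \<sigma> i * h (p i)) - h b * (\<Sum>i\<in>I. \<sigma> i)"
    by (simp add: sum_subtractf[symmetric] sum_distrib_left algebra_simps)
  finally show ?thesis using total by simp
qed

section \<open>Flat faces and their shadows along a direction\<close>

text \<open>The parameter at which the line through \<open>y\<close> in direction \<open>v\<close> meets the hyperplane that contains
  \<open>F\<close> and has normal \<open>n\<close>.  The offset of that hyperplane is recovered from \<open>F\<close> by a choice, so
  that the notion depends only on the data of the element.\<close>

definition crossing :: "(real^'d) set \<Rightarrow> real^'d::finite \<Rightarrow> real^'d \<Rightarrow> real^'d \<Rightarrow> real" where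
  "crossing F n v y = ((SOME c. \<forall>x\<in>F. n \<bullet> x = c) - n \<bullet> y) / (n \<bullet> v)"

locale flat_face =
  fixes F :: "(real^'d::finite) set" and n :: "real^'d" and c :: real
  assumes polytope_face: "polytope F" and dim_face: "aff_dim F = int CARD('d) - 1"
    and norm_n: "norm n = 1" and plane: "\<And>x. x \<in> F \<Longrightarrow> n \<bullet> x = c"
begin

lemma compact_face: "compact F" and convex_face: "convex F"
  using polytope_face by (auto simp: polytope_imp_compact polytope_imp_convex)

lemma nonempty_face: "F \<noteq> {}"
  using dim_face aff_dim_empty[of F] by auto

lemma n_nz: "n \<noteq> 0" using norm_n by auto

lemma nn: "n \<bullet> n = 1" using norm_n by (simp add: dot_square_norm)

lemma affine_hull_face: "affine hull F = {x. n \<bullet> x = c}"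
proof (rule affine_dim_equal)
  show "affine hull F \<subseteq> {x. n \<bullet> x = c}"
    using plane by (intro hull_minimal affine_hyperplane) auto
  show "aff_dim (affine hull F) = aff_dim {x. n \<bullet> x = c}"
    using n_nz dim_face by (simp add: aff_dim_hyperplane)
qed (use nonempty_face in \<open>auto simp: affine_hyperplane\<close>)

lemma crossing_eq: "crossing F n v y = (c - n \<bullet> y) / (n \<bullet> v)"
proof -
  have "(SOME c'. \<forall>x\<in>F. n \<bullet> x = c') = c"
    using plane nonempty_face by (intro some_equality) fastforce+
  then show ?thesis by (simp add: crossing_def)
qed

text \<open>Identifies the nearest point projection in the definition of the face integral.\<close>

lemma closest_point_face:
  assumes "x \<in> F"
  shows "closest_point (affine hull F) (x + s *\<^sub>R n) = x"
proof (rule closest_point_unique[symmetric])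
  show "convex (affine hull F)" "closed (affine hull F)" 
    by (auto simp: affine_hull_face convex_hyperplane closed_hyperplane)
  show "x \<in> affine hull F" using assms hull_inc by metis
  show "\<forall>z\<in>affine hull F. dist (x + s *\<^sub>R n) x \<le> dist (x + s *\<^sub>R n) z"
  proof
    fix z assume "z \<in> affine hull F"
    then have z: "n \<bullet> (x - z) = 0"
      using plane[OF assms] by (simp add: affine_hull_face inner_diff_right)
    have "(norm (x + s *\<^sub>R n - z))\<^sup>2 = (norm (x - z))\<^sup>2 + (norm (s *\<^sub>R n))\<^sup>2"
      unfolding power2_norm_eq_inner using z by (simp add: inner_add inner_diff inner_commute)
    then have "(norm (s *\<^sub>R n))\<^sup>2 \<le> (norm (x + s *\<^sub>R n - z))\<^sup>2" by simp
    then show "dist (x + s *\<^sub>R n) x \<le> dist (x + s *\<^sub>R n) z"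
      using power2_le_imp_le by (fastforce simp: dist_norm)
  qed
qed

text \<open>The oblique prism of height one over the face in direction \<open>u\<close>, written as a condition on its points:
  \<open>n \<bullet> z - c\<close> is the height of \<open>z\<close>, and sliding back by this height along \<open>u\<close> ends in the face.\<close>

lemma compact_prism:
  assumes "n \<bullet> u = 1"
  shows "compact {z. 0 \<le> n \<bullet> z - c \<and> n \<bullet> z - c \<le> 1 \<and> z - (n \<bullet> z - c) *\<^sub>R u \<in> F}" (is "compact ?C")
proof -
  have "?C = (\<lambda>(x, s). x + s *\<^sub>R u) ` (F \<times> {0..1})"
  proof (intro equalityI subsetI)
    fix z assume z: "z \<in> ?C"
    then show "z \<in> (\<lambda>(x, s). x + s *\<^sub>R u) ` (F \<times> {0..1})"
      by (intro image_eqI[where x = "(z - (n \<bullet> z - c) *\<^sub>R u, n \<bullet> z - c)"]) auto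
  next
    fix z assume "z \<in> (\<lambda>(x, s). x + s *\<^sub>R u) ` (F \<times> {0..1})"
    then show "z \<in> ?C"
      using plane assms by (auto simp: inner_add_right)
  qed
  moreover have "compact ((\<lambda>(x, s). x + s *\<^sub>R u) ` (F \<times> {0..1}))"
    unfolding case_prod_unfold
    by (intro compact_continuous_image compact_Times compact_face continuous_intros) auto
  ultimately show ?thesis by simp
qed

lemma prism_integrable:
  assumes u: "n \<bullet> u = 1" and f: "continuous_on UNIV f"
  shows "integrable lborel (\<lambda>z. indicator {z. 0 \<le> n \<bullet> z - c \<and> n \<bullet> z - c \<le> 1 \<and>
    z - (n \<bullet> z - c) *\<^sub>R u \<in> F} z * (f (z - (n \<bullet> z - c) *\<^sub>R u) :: real))"
proof -
  have "continuous_on UNIV (\<lambda>z. f (z - (n \<bullet> z - c) *\<^sub>R u))"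
    by (rule continuous_on_compose2[OF f]) (auto intro!: continuous_intros)
  then show ?thesis
    using borel_integrable_compact[OF compact_prism[OF u], of "\<lambda>z. f (z - (n \<bullet> z - c) *\<^sub>R u)"]
      continuous_on_subset by (auto simp: mult.commute)
qed

lemma face_integral_eq:
  "face_integral F n f = (\<integral>z. indicator {z. 0 \<le> n \<bullet> z - c \<and> n \<bullet> z - c \<le> 1 \<and>
    z - (n \<bullet> z - c) *\<^sub>R n \<in> F} z * f (z - (n \<bullet> z - c) *\<^sub>R n) \<partial>lborel)"
proof -
  let ?C = "{z. 0 \<le> n \<bullet> z - c \<and> n \<bullet> z - c \<le> 1 \<and> z - (n \<bullet> z - c) *\<^sub>R n \<in> F}"
  have C: "{x + s *\<^sub>R n | x s. x \<in> F \<and> 0 \<le> s \<and> s \<le> 1} = ?C"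
  proof (intro equalityI subsetI)
    fix z assume "z \<in> ?C"
    then show "z \<in> {x + s *\<^sub>R n | x s. x \<in> F \<and> 0 \<le> s \<and> s \<le> 1}"
      by (intro CollectI exI[of _ "z - (n \<bullet> z - c) *\<^sub>R n"] exI[of _ "n \<bullet> z - c"]) auto
  qed (use plane nn in \<open>auto simp: inner_add_right\<close>)
  have "closest_point (affine hull F) z = z - (n \<bullet> z - c) *\<^sub>R n" if "z \<in> ?C" for z
    using that closest_point_face[of "z - (n \<bullet> z - c) *\<^sub>R n" "n \<bullet> z - c"] by simp
  then show ?thesis
    unfolding face_integral_def set_lebesgue_integral_def C
    by (intro Bochner_Integration.integral_cong) (auto simp: indicator_def)
qed

text \<open>A shear parallel to the face tilts the right prism into the oblique one and preserves Lebesgue measure,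
  so the direction of the prism does not matter.\<close>

lemma prism_integral_indep:
  assumes u: "n \<bullet> u = 1" and f: "continuous_on UNIV f"
  shows "(\<integral>z. indicator {z. 0 \<le> n \<bullet> z - c \<and> n \<bullet> z - c \<le> 1 \<and>
    z - (n \<bullet> z - c) *\<^sub>R u \<in> F} z * f (z - (n \<bullet> z - c) *\<^sub>R u) \<partial>lborel) = face_integral F n f"
    (is "(\<integral>z. ?g z \<partial>lborel) = _")
proof -
  have w: "n \<bullet> (u - n) = 0" using u nn by (simp add: inner_diff_right)
  let ?T = "\<lambda>z. z + (n \<bullet> z - c) *\<^sub>R (u - n)"
  have [measurable]: "?g \<in> borel_measurable borel"
    using borel_measurable_integrable[OF prism_integrable[OF u f]] by simp
  have nT: "n \<bullet> ?T z = n \<bullet> z" for z using w by (simp add: inner_add_right)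
  have "(\<integral>z. ?g z \<partial>lborel) = (\<integral>z. ?g z \<partial>distr lborel borel ?T)"
    by (simp only: lborel_distr_shear[OF w])
  also have "\<dots> = (\<integral>z. ?g (?T z) \<partial>lborel)"
    by (rule integral_distr) measurable
  also have "\<dots> = face_integral F n f"
    unfolding face_integral_eq
  proof (rule Bochner_Integration.integral_cong[OF refl])
    fix z
    have e: "?T z - (n \<bullet> z - c) *\<^sub>R u = z - (n \<bullet> z - c) *\<^sub>R n"
      by (simp add: algebra_simps)
    show "?g (?T z) = indicator {z. 0 \<le> n \<bullet> z - c \<and> n \<bullet> z - c \<le> 1 \<and>
        z - (n \<bullet> z - c) *\<^sub>R n \<in> F} z * f (z - (n \<bullet> z - c) *\<^sub>R n)"
      by (simp only: indicator_def mem_Collect_eq nT e)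
  qed
  finally show ?thesis .
qed

text \<open>The value of \<open>f\<close> at the crossing point, averaged over all lines of direction \<open>v\<close> that hit the face:
  a line stays in the prism of height one in direction \<open>v\<close> for the time \<open>1 / \<bar>n \<bullet> v\<bar>\<close>, which is where
  the factor \<open>\<bar>n \<bullet> v\<bar>\<close> comes from.\<close>

lemma
  assumes v: "v \<bullet> v = 1" and nv: "n \<bullet> v \<noteq> 0" and f: "continuous_on UNIV f"
  defines "\<kappa> \<equiv> \<lambda>y. indicator {0..1} (v \<bullet> y) *
     (indicator F (y + crossing F n v y *\<^sub>R v) * f (y + crossing F n v y *\<^sub>R v)) :: real"
  shows face_shadow_integrable: "integrable lborel \<kappa>"
    and face_shadow_integral: "integral\<^sup>L lborel \<kappa> = \<bar>n \<bullet> v\<bar> * face_integral F n f"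
proof -
  define d where "d = n \<bullet> v"
  have d: "d \<noteq> 0" using nv by (simp add: d_def)
  define u where "u = (1 / d) *\<^sub>R v"
  have u: "n \<bullet> u = 1" using d by (simp add: u_def d_def)
  define g where "g = (\<lambda>z. indicator {z. 0 \<le> n \<bullet> z - c \<and> n \<bullet> z - c \<le> 1 \<and>
    z - (n \<bullet> z - c) *\<^sub>R u \<in> F} z * f (z - (n \<bullet> z - c) *\<^sub>R u))"
  have g: "integrable lborel g" unfolding g_def by (rule prism_integrable[OF u f])
  have inner: "(\<integral>s. g (y + s *\<^sub>R v) \<partial>lborel) = (1 / \<bar>d\<bar>) *
      (indicator F (y + crossing F n v y *\<^sub>R v) * f (y + crossing F n v y *\<^sub>R v))" for y
  proof -
    let ?q = "y + crossing F n v y *\<^sub>R v"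
    have q: "(y + s *\<^sub>R v) - (n \<bullet> (y + s *\<^sub>R v) - c) *\<^sub>R u = ?q" for s
    proof -
      have "s - (n \<bullet> (y + s *\<^sub>R v) - c) / d = crossing F n v y"
        using d by (simp add: crossing_eq inner_add_right d_def[symmetric] field_simps)
      then have "s *\<^sub>R v - ((n \<bullet> (y + s *\<^sub>R v) - c) / d) *\<^sub>R v = crossing F n v y *\<^sub>R v"
        by (metis scaleR_left_diff_distrib)
      then show ?thesis
        by (simp add: u_def flip: add_diff_eq)
    qed
    have nq: "n \<bullet> (y + s *\<^sub>R v) - c = (n \<bullet> y - c) + d * s" for s
      by (simp add: inner_add_right d_def)
    have "(\<integral>s. g (y + s *\<^sub>R v) \<partial>lborel)
        = (\<integral>s. indicator {0..1} ((n \<bullet> y - c) + d * s) * (indicator F ?q * f ?q) \<partial>lborel)"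
      unfolding g_def mem_Collect_eq indicator_def nq q[unfolded nq]
      by (intro Bochner_Integration.integral_cong refl) auto
    also have "\<dots> = (\<integral>s. indicator {0..1} ((n \<bullet> y - c) + d * s) \<partial>lborel) * (indicator F ?q * f ?q)"
      by simp
    also have "(\<integral>s. indicator {0..1::real} ((n \<bullet> y - c) + d * s) \<partial>lborel) = 1 / \<bar>d\<bar>"
      using lborel_integral_real_affine[OF d, of "indicator {0..1} :: real \<Rightarrow> real" "n \<bullet> y - c"] d
      by (simp add: field_simps)
    finally show ?thesis .
  qed
  have eq: "\<kappa> = (\<lambda>y. \<bar>d\<bar> * (indicator {0..1} (v \<bullet> y - 0) * (\<integral>s. g (y + s *\<^sub>R v) \<partial>lborel)))"
    using d by (auto simp: \<kappa>_def inner fun_eq_iff)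
  show "integrable lborel \<kappa>"
    unfolding eq by (intro integrable_mult_right impI integrable_line_average v g)
  have "integral\<^sup>L lborel \<kappa> = \<bar>d\<bar> * integral\<^sup>L lborel g"
    unfolding eq integral_mult_right_zero
    by (subst integral_line_average[OF v g, of 0]) simp
  also have "integral\<^sup>L lborel g = face_integral F n f"
    unfolding g_def by (rule prism_integral_indep[OF u f])
  finally show "integral\<^sup>L lborel \<kappa> = \<bar>n \<bullet> v\<bar> * face_integral F n f" by (simp add: d_def)
qed

lemma negligible_parallel_lines:
  assumes "n \<bullet> v = 0"
  shows "negligible {y. \<exists>s. y + s *\<^sub>R v \<in> F}"
proof (rule negligible_subset[OF negligible_hyperplane])
  show "n \<noteq> 0 \<or> c \<noteq> 0" using n_nz by simp
  show "{y. \<exists>s. y + s *\<^sub>R v \<in> F} \<subseteq> {y. n \<bullet> y = c}"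
    using plane assms by (fastforce simp: inner_add_right)
qed

text \<open>The lines that meet the face form a convex cylinder \<open>K\<close>, and those through its relative boundary lie in
  the frontier of \<open>K\<close>.  A line in the interior of \<open>K\<close> meets the hyperplane of the face in a relative
  interior point.\<close>

lemma negligible_boundary_lines:
  assumes nv: "n \<bullet> v \<noteq> 0"
  shows "negligible {y. \<exists>s. y + s *\<^sub>R v \<in> F - rel_interior F}"
proof (rule negligible_subset[OF negligible_convex_frontier])
  define \<pi> where "\<pi> y = y + crossing F n v y *\<^sub>R v" for y
  define K where "K = {y. \<pi> y \<in> F}"
  have \<pi>: "\<pi> y = y + ((c - n \<bullet> y) / (n \<bullet> v)) *\<^sub>R v" for y by (simp add: \<pi>_def crossing_eq)
  have n\<pi>: "n \<bullet> \<pi> y = c" for y using nv by (simp add: \<pi> inner_add_right)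
  have fix\<pi>: "\<pi> y = y" if "n \<bullet> y = c" for y using that by (simp add: \<pi>)
  have along: "\<pi> (y + s *\<^sub>R v) = \<pi> y" for y s
    using nv by (simp add: \<pi> inner_add_right diff_divide_distrib add_divide_distrib algebra_simps)
  show "convex K"
  proof (rule convexI)
    fix x y :: "real^'d" and a b :: real
    assume xy: "x \<in> K" "y \<in> K" "0 \<le> a" "0 \<le> b" "a + b = 1"
    have "\<pi> (a *\<^sub>R x + b *\<^sub>R y) = a *\<^sub>R \<pi> x + b *\<^sub>R \<pi> y"
    proof -
      have "c = a * c + b * c" using xy(5) by (simp flip: distrib_right)
      then have "c - n \<bullet> (a *\<^sub>R x + b *\<^sub>R y) = a * (c - n \<bullet> x) + b * (c - n \<bullet> y)"
        by (simp add: inner_add_right right_diff_distrib)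
      then have "(c - n \<bullet> (a *\<^sub>R x + b *\<^sub>R y)) / (n \<bullet> v)
          = a * ((c - n \<bullet> x) / (n \<bullet> v)) + b * ((c - n \<bullet> y) / (n \<bullet> v))"
        by (simp add: add_divide_distrib)
      then show ?thesis
        by (simp only: \<pi> scaleR_add_left scaleR_add_right scaleR_scaleR ac_simps)
    qed
    then show "a *\<^sub>R x + b *\<^sub>R y \<in> K"
      using xy convex_face by (auto simp: K_def convex_def)
  qed
  show "{y. \<exists>s. y + s *\<^sub>R v \<in> F - rel_interior F} \<subseteq> frontier K"
  proof
    fix y assume "y \<in> {y. \<exists>s. y + s *\<^sub>R v \<in> F - rel_interior F}"
    then obtain s where s: "y + s *\<^sub>R v \<in> F" "y + s *\<^sub>R v \<notin> rel_interior F" by auto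
    then have \<pi>y: "\<pi> y = y + s *\<^sub>R v"
      using fix\<pi>[of "y + s *\<^sub>R v"] along[of y s] plane by auto
    have "y \<in> K" using \<pi>y s by (simp add: K_def)
    moreover have "y \<notin> interior K"
    proof
      assume "y \<in> interior K"
      then obtain \<epsilon> where \<epsilon>: "\<epsilon> > 0" "ball y \<epsilon> \<subseteq> K" by (auto simp: mem_interior)
      have "z \<in> F" if "dist (y + s *\<^sub>R v) z < \<epsilon>" "n \<bullet> z = c" for z
      proof -
        have "z - s *\<^sub>R v \<in> K" using \<epsilon> that by (auto simp: dist_norm algebra_simps)
        then have "\<pi> (z - s *\<^sub>R v) \<in> F" by (simp add: K_def)
        moreover have "\<pi> z = \<pi> (z - s *\<^sub>R v)" using along[of "z - s *\<^sub>R v" s] by simp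
        ultimately show ?thesis using fix\<pi> that by simp
      qed
      then have "y + s *\<^sub>R v \<in> rel_interior F"
        unfolding mem_rel_interior_ball affine_hull_face using s \<epsilon>(1) by (auto intro!: exI[of _ \<epsilon>])
      then show False using s by simp
    qed
    ultimately show "y \<in> frontier K" using closure_subset by (auto simp: frontier_def)
  qed
qed

end

section \<open>Divergence theorem on polyhedral elements\<close>

lemma flat_face_of_element:
  assumes "polyhedral_element \<Omega> Fs \<nu>" "F \<in> Fs"
  shows "flat_face F (\<nu> F) (SOME c. \<forall>x\<in>F. \<nu> F \<bullet> x = c)"
proof
  show "polytope F" "aff_dim F = int CARD('a) - 1" "norm (\<nu> F) = 1"
    using assms by (auto simp: polyhedral_element_def)
  have flat: "\<nu> F \<bullet> (x - y) = 0" if "x \<in> F" "y \<in> F" for x y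
    using assms that by (auto simp: polyhedral_element_def)
  have "\<exists>c. \<forall>x\<in>F. \<nu> F \<bullet> x = c"
  proof (cases "F = {}")
    case False
    then obtain x0 where x0: "x0 \<in> F" by blast
    have "\<nu> F \<bullet> x = \<nu> F \<bullet> x0" if "x \<in> F" for x
      using flat[OF that x0] by (simp add: inner_diff_right)
    then show ?thesis by blast
  qed auto
  then show "\<nu> F \<bullet> x = (SOME c. \<forall>x\<in>F. \<nu> F \<bullet> x = c)" if "x \<in> F" for x
    using someI_ex[of "\<lambda>c. \<forall>x\<in>F. \<nu> F \<bullet> x = c"] that by blast
qed

lemma connected_inside_or_outside:
  assumes "connected S" "S \<inter> frontier T = {}" "a \<in> S"
  shows "a \<in> T \<Longrightarrow> S \<subseteq> T" and "a \<notin> T \<Longrightarrow> S \<inter> T = {}"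
  using connected_Int_frontier[of S T] assms by blast+

text \<open>The element is only known to lie on the inner side of a face along the normal.  Near a relative interior
  point that lies on no other face, the two open half balls do not meet the frontier of the element.
  Being connected, each lies entirely inside or outside, so the information
  along the normal carries over to every transversal direction \<open>v\<close>.\<close>

lemma element_sides_of_face:
  assumes el: "polyhedral_element \<Omega> Fs \<nu>" and F: "F \<in> Fs" and x: "x \<in> rel_interior F"
    and only: "\<And>F'. F' \<in> Fs \<Longrightarrow> x \<in> F' \<Longrightarrow> F' = F"
    and v: "norm v = 1" and d: "\<nu> F \<bullet> v \<noteq> 0"
  shows "\<exists>\<delta>>0. \<forall>t. 0 < t \<and> t < \<delta> \<longrightarrow>
    x - (sgn (\<nu> F \<bullet> v) * t) *\<^sub>R v \<in> \<Omega> \<and> x + (sgn (\<nu> F \<bullet> v) * t) *\<^sub>R v \<notin> \<Omega>"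
proof -
  define c where "c = (SOME c. \<forall>x\<in>F. \<nu> F \<bullet> x = c)"
  interpret flat_face F "\<nu> F" c
    using flat_face_of_element[OF el F] by (simp add: c_def)
  have nx: "\<nu> F \<bullet> x = c" using x rel_interior_subset plane by blast
  have fr: "\<Union>Fs = frontier \<Omega>" and fin: "finite Fs"
    using el by (auto simp: polyhedral_element_def)
  have "closed (\<Union>(Fs - {F}))"
    using fin flat_face.compact_face[OF flat_face_of_element[OF el]]
    by (intro closed_Union) (auto simp: compact_imp_closed)
  moreover have "x \<notin> \<Union>(Fs - {F})" using only by auto
  ultimately have "open (- \<Union>(Fs - {F}))" "x \<in> - \<Union>(Fs - {F})" by blast+
  then obtain \<delta> where \<delta>: "\<delta> > 0" "ball x \<delta> \<subseteq> - \<Union>(Fs - {F})"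
    by (rule openE)
  have "\<forall>F\<in>Fs. \<forall>x\<in>rel_interior F. \<exists>\<epsilon>>0. \<forall>s. 0 < s \<and> s < \<epsilon> \<longrightarrow>
      x - s *\<^sub>R \<nu> F \<in> \<Omega> \<and> x + s *\<^sub>R \<nu> F \<notin> \<Omega>"
    using el by (simp add: polyhedral_element_def)
  from this[rule_format, OF F x] obtain \<epsilon> where \<epsilon>: "\<epsilon> > 0"
    "\<And>s. 0 < s \<Longrightarrow> s < \<epsilon> \<Longrightarrow> x - s *\<^sub>R \<nu> F \<in> \<Omega> \<and> x + s *\<^sub>R \<nu> F \<notin> \<Omega>"
    by auto
  \<comment> \<open>one point on either side, close enough to lie in the half balls and to obey the local condition\<close>
  define s where "s = min \<delta> \<epsilon> / 2"
  have s: "0 < s" "s < \<delta>" "s < \<epsilon>" using \<delta>(1) \<epsilon>(1) by (auto simp: s_def)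
  let ?P = "ball x \<delta> \<inter> {z. \<nu> F \<bullet> z > c}" and ?M = "ball x \<delta> \<inter> {z. \<nu> F \<bullet> z < c}"
  have "z \<notin> ball x \<delta> \<or> \<nu> F \<bullet> z = c" if "z \<in> frontier \<Omega>" for z
    using that \<delta>(2) plane[of z] unfolding fr[symmetric] by blast
  then have "?P \<inter> frontier \<Omega> = {}" "?M \<inter> frontier \<Omega> = {}"
    by fastforce+
  moreover have "connected ?P" "connected ?M"
    by (auto intro!: convex_connected convex_Int convex_halfspace_lt convex_halfspace_gt)
  moreover have "x + s *\<^sub>R \<nu> F \<in> ?P" "x - s *\<^sub>R \<nu> F \<in> ?M"
    using s nx nn norm_n by (simp_all add: dist_norm inner_add_right inner_diff_right)
  moreover have "x - s *\<^sub>R \<nu> F \<in> \<Omega>" "x + s *\<^sub>R \<nu> F \<notin> \<Omega>"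
    using \<epsilon>(2)[OF s(1,3)] by simp_all
  ultimately have P: "?P \<inter> \<Omega> = {}" and M: "?M \<subseteq> \<Omega>"
    using connected_inside_or_outside by metis+
  show ?thesis
  proof (intro exI[of _ \<delta>] conjI allI impI \<delta>(1))
    fix t assume t: "0 < t \<and> t < \<delta>"
    have abs: "sgn (\<nu> F \<bullet> v) * t * (\<nu> F \<bullet> v) = \<bar>\<nu> F \<bullet> v\<bar> * t" by (simp add: abs_sgn mult_ac)
    then have pos: "sgn (\<nu> F \<bullet> v) * t * (\<nu> F \<bullet> v) > 0"
      unfolding abs using t d by simp
    have "\<bar>sgn (\<nu> F \<bullet> v) * t\<bar> = t" using t d by (simp add: abs_mult abs_sgn_eq)
    then have "dist x (x - (sgn (\<nu> F \<bullet> v) * t) *\<^sub>R v) < \<delta>" "dist x (x + (sgn (\<nu> F \<bullet> v) * t) *\<^sub>R v) < \<delta>"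
      using t v by (simp_all add: dist_norm)
    then have M': "x - (sgn (\<nu> F \<bullet> v) * t) *\<^sub>R v \<in> ?M"
      and P': "x + (sgn (\<nu> F \<bullet> v) * t) *\<^sub>R v \<in> ?P"
      using pos nx by (simp_all add: inner_add_right inner_diff_right)
    show "x - (sgn (\<nu> F \<bullet> v) * t) *\<^sub>R v \<in> \<Omega>" by (rule subsetD[OF M M'])
    show "x + (sgn (\<nu> F \<bullet> v) * t) *\<^sub>R v \<notin> \<Omega>"
    proof
      assume "x + (sgn (\<nu> F \<bullet> v) * t) *\<^sub>R v \<in> \<Omega>"
      with P' have "x + (sgn (\<nu> F \<bullet> v) * t) *\<^sub>R v \<in> ?P \<inter> \<Omega>" by (rule IntI)
      then show False by (simp only: P empty_iff)
    qed
  qed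
qed

text \<open>Lines in the hyperplane of a face or through a relative boundary point of a face are excluded; they
  form a null set.\<close>

definition generic_line :: "(real^'d::finite) set set \<Rightarrow> ((real^'d) set \<Rightarrow> real^'d) \<Rightarrow> real^'d \<Rightarrow> real^'d \<Rightarrow> bool" where
  "generic_line Fs \<nu> v y \<longleftrightarrow>
     (\<forall>F\<in>Fs. \<forall>s. y + s *\<^sub>R v \<in> F \<longrightarrow> \<nu> F \<bullet> v \<noteq> 0 \<and> y + s *\<^sub>R v \<in> rel_interior F)"

lemma AE_generic_line:
  assumes el: "polyhedral_element \<Omega> Fs \<nu>"
  shows "AE y in lborel. generic_line Fs \<nu> v y"
proof -
  let ?bad = "\<lambda>F. {y. \<exists>s. y + s *\<^sub>R v \<in> F \<and> (\<nu> F \<bullet> v = 0 \<or> y + s *\<^sub>R v \<notin> rel_interior F)}"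
  have "negligible (?bad F)" if "F \<in> Fs" for F
  proof -
    interpret flat_face F "\<nu> F" "SOME c. \<forall>x\<in>F. \<nu> F \<bullet> x = c"
      by (rule flat_face_of_element[OF el that])
    show ?thesis
    proof (cases "\<nu> F \<bullet> v = 0")
      case True
      show ?thesis
        by (rule negligible_subset[OF negligible_parallel_lines[OF True]]) auto
    next
      case False
      show ?thesis
        by (rule negligible_subset[OF negligible_boundary_lines[OF False]]) (use False in auto)
    qed
  qed
  moreover have "finite Fs" using el by (simp add: polyhedral_element_def)
  ultimately have "negligible (\<Union>F\<in>Fs. ?bad F)"
    by (intro negligible_Union) auto
  then have "AE y in lebesgue. y \<notin> (\<Union>F\<in>Fs. ?bad F)"
    by (intro AE_not_in) (simp add: negligible_iff_null_sets)
  then have "AE y in lborel. y \<notin> (\<Union>F\<in>Fs. ?bad F)"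
    by (simp add: AE_completion_iff)
  then show ?thesis
  proof eventually_elim
    case (elim y)
    show ?case
      unfolding generic_line_def
    proof (intro ballI allI impI)
      fix F s assume "F \<in> Fs" "y + s *\<^sub>R v \<in> F"
      moreover have "y \<notin> ?bad F" using elim \<open>F \<in> Fs\<close> by (rule contrapos_nn[OF _ UN_I])
      ultimately show "\<nu> F \<bullet> v \<noteq> 0 \<and> y + s *\<^sub>R v \<in> rel_interior F" by blast
    qed
  qed
qed

text \<open>The line through \<open>y\<close> cuts \<open>\<Omega>\<close> in a compact set of parameters whose boundary points are the crossing
  parameters of the faces.  Faces that are not hit contribute zero to the right-hand side.\<close>

lemma line_integral_element:
  assumes el: "polyhedral_element \<Omega> Fs \<nu>" and y: "generic_line Fs \<nu> v y" and v: "v \<bullet> v = 1"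
    and f: "\<And>x. (f has_derivative f' x) (at x)" and f': "continuous_on UNIV (\<lambda>x. f' x v)"
  shows "(\<integral>s. indicator \<Omega> (y + s *\<^sub>R v) * f' (y + s *\<^sub>R v) v \<partial>lborel) =
    (\<Sum>F | F \<in> Fs \<and> \<nu> F \<bullet> v \<noteq> 0. sgn (\<nu> F \<bullet> v) *
      (indicator F (y + crossing F (\<nu> F) v y *\<^sub>R v) * f (y + crossing F (\<nu> F) v y *\<^sub>R v)))"
proof -
  let ?L = "\<lambda>s. y + s *\<^sub>R v"
  define J where "J = ?L -` \<Omega>"
  define p where "p F = crossing F (\<nu> F) v y" for F
  define I where "I = {F \<in> Fs. \<nu> F \<bullet> v \<noteq> 0 \<and> ?L (p F) \<in> F}"
  have nv: "norm v = 1" using v by (simp add: norm_eq_1)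
  have cpt: "compact \<Omega>" and fin: "finite Fs" and fr: "\<Union>Fs = frontier \<Omega>"
    and disj: "\<And>F F'. F \<in> Fs \<Longrightarrow> F' \<in> Fs \<Longrightarrow> F \<noteq> F' \<Longrightarrow> rel_interior F \<inter> rel_interior F' = {}"
    using el by (auto simp: polyhedral_element_def)
  have only: "F = F'" if "F \<in> Fs" "F' \<in> Fs" "?L s \<in> F" "?L s \<in> F'" for F F' s
    using y that disj[of F F'] unfolding generic_line_def by blast
  have onI: "F \<in> I \<and> s = p F" if "F \<in> Fs" "?L s \<in> F" for F s
  proof -
    interpret flat_face F "\<nu> F" "SOME c. \<forall>x\<in>F. \<nu> F \<bullet> x = c"
      by (rule flat_face_of_element[OF el that(1)])
    have d: "\<nu> F \<bullet> v \<noteq> 0" using y that by (auto simp: generic_line_def)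
    then have "s = p F"
      using plane[OF that(2)] by (simp add: p_def crossing_eq inner_add_right field_simps)
    then show ?thesis using that d by (simp add: I_def)
  qed
  have contL: "continuous_on UNIV ?L" by (intro continuous_intros)
  have closedJ: "closed J"
    unfolding J_def using cpt contL by (intro closed_vimage) (auto simp: compact_imp_closed)
  have "bounded J"
  proof -
    obtain b where b: "\<And>x. x \<in> \<Omega> \<Longrightarrow> norm x \<le> b"
      using cpt compact_imp_bounded bounded_iff by metis
    have "\<bar>s\<bar> \<le> b + norm y" if "s \<in> J" for s
    proof -
      have "\<bar>s\<bar> = norm (?L s - y)" using nv by simp
      also have "\<dots> \<le> norm (?L s) + norm y" by (rule norm_triangle_ineq4)
      finally show ?thesis using b[of "?L s"] that by (simp add: J_def)
    qed
    then show ?thesis by (auto simp: bounded_iff)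
  qed
  with closedJ have J: "compact J" by (simp add: compact_eq_bounded_closed)
  have frJ: "frontier J \<subseteq> p ` I"
  proof
    fix s assume s: "s \<in> frontier J"
    then have "?L s \<in> \<Omega>" "s \<notin> interior J"
      using closedJ by (auto simp: frontier_def J_def)
    moreover have "open (?L -` interior \<Omega>)"
      using contL by (intro open_vimage) auto
    then have "?L -` interior \<Omega> \<subseteq> interior J"
      using interior_subset by (intro interior_maximal) (auto simp: J_def)
    ultimately have "?L s \<in> frontier \<Omega>"
      using closure_subset by (auto simp: frontier_def)
    then obtain F where "F \<in> Fs" "?L s \<in> F" using fr by auto
    then show "s \<in> p ` I" using onI by blast
  qed
  have "(\<integral>s. indicator J s * f' (?L s) v \<partial>lborel) = (\<Sum>F\<in>I. sgn (\<nu> F \<bullet> v) * f (?L (p F)))"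
  proof (rule integral_deriv_signed_crossings[OF J _ _ frJ])
    show "finite I" using fin by (simp add: I_def)
    show "inj_on p I" using only by (force simp: inj_on_def I_def)
    fix F assume F: "F \<in> I"
    then show "sgn (\<nu> F \<bullet> v) = 1 \<or> sgn (\<nu> F \<bullet> v) = -1" by (auto simp: I_def sgn_if)
    have "?L (p F) \<in> rel_interior F" using F y by (auto simp: I_def generic_line_def)
    from element_sides_of_face[OF el _ this _ nv] F only
    show "\<exists>\<delta>>0. \<forall>t. 0 < t \<and> t < \<delta> \<longrightarrow> p F - sgn (\<nu> F \<bullet> v) * t \<in> J \<and> p F + sgn (\<nu> F \<bullet> v) * t \<notin> J"
      by (auto simp: I_def J_def scaleR_left_distrib scaleR_left_diff_distrib algebra_simps)
  next
    fix s
    have "((\<lambda>s. f (?L s)) has_derivative (\<lambda>t. f' (?L s) (t *\<^sub>R v))) (at s)"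
      by (rule has_derivative_compose[OF _ f]) (auto intro!: derivative_eq_intros)
    moreover have "f' (?L s) (t *\<^sub>R v) = f' (?L s) v * t" for t
      using linear_cmul[OF has_derivative_linear[OF f[of "?L s"]], of t v] by simp
    ultimately show "((\<lambda>s. f (?L s)) has_real_derivative f' (?L s) v) (at s)"
      by (simp add: has_field_derivative_def)
  next
    show "continuous_on UNIV (\<lambda>s. f' (?L s) v)"
      by (rule continuous_on_compose2[OF f' contL]) auto
  qed
  also have "\<dots> = (\<Sum>F | F \<in> Fs \<and> \<nu> F \<bullet> v \<noteq> 0. sgn (\<nu> F \<bullet> v) * (indicator F (?L (p F)) * f (?L (p F))))"
    using fin by (intro sum.mono_neutral_cong_left) (auto simp: I_def indicator_def split: if_splits)
  finally show ?thesis
    unfolding p_def by (simp add: J_def indicator_def)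
qed

text \<open>Both sides are integrals over the base points of lines, and their integrands agree on every generic line.\<close>

theorem polyhedral_divergence:
  assumes el: "polyhedral_element \<Omega> Fs \<nu>" and v: "v \<bullet> v = 1"
    and f: "\<And>x. (f has_derivative f' x) (at x)" and f': "continuous_on UNIV (\<lambda>x. f' x v)"
  shows "(LINT x:\<Omega>|lborel. f' x v) = (\<Sum>F\<in>Fs. (\<nu> F \<bullet> v) * face_integral F (\<nu> F) f)"
proof -
  let ?g = "\<lambda>x. indicator \<Omega> x * f' x v"
  let ?\<kappa> = "\<lambda>F y. indicator {0..1} (v \<bullet> y) * (indicator F (y + crossing F (\<nu> F) v y *\<^sub>R v)
      * f (y + crossing F (\<nu> F) v y *\<^sub>R v)) :: real"
  let ?Fs = "{F. F \<in> Fs \<and> \<nu> F \<bullet> v \<noteq> 0}"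
  have cpt: "compact \<Omega>" and fin: "finite Fs" using el by (auto simp: polyhedral_element_def)
  have contf: "continuous_on UNIV f"
    using has_derivative_continuous[OF f] by (simp add: continuous_on_eq_continuous_at)
  have g: "integrable lborel ?g"
    using borel_integrable_compact[OF cpt continuous_on_subset[OF f']] by simp
  have \<kappa>: "integrable lborel (?\<kappa> F)" "integral\<^sup>L lborel (?\<kappa> F) = \<bar>\<nu> F \<bullet> v\<bar> * face_integral F (\<nu> F) f"
    if "F \<in> ?Fs" for F
  proof -
    interpret flat_face F "\<nu> F" "SOME c. \<forall>x\<in>F. \<nu> F \<bullet> x = c"
      using that by (intro flat_face_of_element[OF el]) auto
    show "integrable lborel (?\<kappa> F)" "integral\<^sup>L lborel (?\<kappa> F) = \<bar>\<nu> F \<bullet> v\<bar> * face_integral F (\<nu> F) f"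
      using face_shadow_integrable face_shadow_integral that v contf by auto
  qed
  have "(LINT x:\<Omega>|lborel. f' x v) = integral\<^sup>L lborel ?g"
    by (simp add: set_lebesgue_integral_def)
  also have "\<dots> = (\<integral>y. indicator {0..1} (v \<bullet> y - 0) * (\<integral>s. ?g (y + s *\<^sub>R v) \<partial>lborel) \<partial>lborel)"
    by (rule integral_line_average[OF v g])
  also have "\<dots> = (\<integral>y. (\<Sum>F\<in>?Fs. sgn (\<nu> F \<bullet> v) * ?\<kappa> F y) \<partial>lborel)"
  proof (rule integral_cong_AE)
    show "(\<lambda>y. indicator {0..1} (v \<bullet> y - 0) * (\<integral>s. ?g (y + s *\<^sub>R v) \<partial>lborel)) \<in> borel_measurable lborel"
      by (rule borel_measurable_integrable[OF integrable_line_average[OF v g]])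
    show "(\<lambda>y. \<Sum>F\<in>?Fs. sgn (\<nu> F \<bullet> v) * ?\<kappa> F y) \<in> borel_measurable lborel"
      by (intro borel_measurable_sum borel_measurable_times borel_measurable_const
          borel_measurable_integrable \<kappa>)
    show "AE y in lborel. indicator {0..1} (v \<bullet> y - 0) * (\<integral>s. ?g (y + s *\<^sub>R v) \<partial>lborel)
        = (\<Sum>F\<in>?Fs. sgn (\<nu> F \<bullet> v) * ?\<kappa> F y)"
      using AE_generic_line[OF el, of v]
      by eventually_elim
        (simp add: line_integral_element[OF el _ v f f'] sum_distrib_left mult_ac)
  qed
  also have "\<dots> = (\<Sum>F\<in>?Fs. sgn (\<nu> F \<bullet> v) * integral\<^sup>L lborel (?\<kappa> F))"
    using \<kappa>(1) by (subst Bochner_Integration.integral_sum) auto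
  also have "\<dots> = (\<Sum>F\<in>?Fs. (\<nu> F \<bullet> v) * face_integral F (\<nu> F) f)"
    using \<kappa>(2) by (intro sum.cong) (auto simp: sgn_if)
  also have "\<dots> = (\<Sum>F\<in>Fs. (\<nu> F \<bullet> v) * face_integral F (\<nu> F) f)"
    using fin by (intro sum.mono_neutral_left) auto
  finally show ?thesis .
qed

section \<open>Symmetry of second derivatives\<close>

lemma has_derivative_cart_iff:
  fixes f :: "'a::real_normed_vector \<Rightarrow> ('b::euclidean_space)^'n"
  shows "(f has_derivative f') (at x within S) \<longleftrightarrow>
    (\<forall>i. ((\<lambda>x. f x $ i) has_derivative (\<lambda>h. f' h $ i)) (at x within S))"
proof
  assume "(f has_derivative f') (at x within S)"
  then show "\<forall>i. ((\<lambda>x. f x $ i) has_derivative (\<lambda>h. f' h $ i)) (at x within S)"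
    by (auto intro: bounded_linear.has_derivative[OF bounded_linear_vec_nth])
next
  assume *: "\<forall>i. ((\<lambda>x. f x $ i) has_derivative (\<lambda>h. f' h $ i)) (at x within S)"
  have axis: "bounded_linear (axis i :: 'b \<Rightarrow> 'b^'n)" for i
    unfolding linear_conv_bounded_linear[symmetric]
    by (rule linearI) (simp_all add: axis_def vec_eq_iff)
  have "((\<lambda>x. \<Sum>i\<in>UNIV. axis i (f x $ i)) has_derivative (\<lambda>h. \<Sum>i\<in>UNIV. axis i (f' h $ i)))
      (at x within S)"
    by (intro has_derivative_sum bounded_linear.has_derivative[OF axis] *[rule_format])
  moreover have "(\<Sum>i\<in>UNIV. axis i (z $ i)) = z" for z :: "'b^'n"
    by (simp add: vec_eq_iff axis_def if_distrib[of "\<lambda>z. z $ _"] cong: if_cong)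
  ultimately show "(f has_derivative f') (at x within S)" by simp
qed

lemma differentiable_cart_iff:
  fixes f :: "'a::real_normed_vector \<Rightarrow> ('b::euclidean_space)^'n"
  shows "f differentiable (at x within S) \<longleftrightarrow> (\<forall>i. (\<lambda>x. f x $ i) differentiable (at x within S))"
proof
  assume *: "\<forall>i. (\<lambda>x. f x $ i) differentiable (at x within S)"
  then obtain f' where "\<And>i. ((\<lambda>x. f x $ i) has_derivative f' i) (at x within S)"
    unfolding differentiable_def by metis
  then have "(f has_derivative (\<lambda>h. \<chi> i. f' i h)) (at x within S)"
    by (subst has_derivative_cart_iff) simp
  then show "f differentiable (at x within S)" by (auto simp: differentiable_def)
qed (auto simp: differentiable_def has_derivative_cart_iff)

lemma frechet_derivative_cart:
  fixes f :: "'a::real_normed_vector \<Rightarrow> ('b::euclidean_space)^'n"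
  assumes "f differentiable (at x)"
  shows "frechet_derivative f (at x) h $ i = frechet_derivative (\<lambda>x. f x $ i) (at x) h"
  using assms frechet_derivative_works[of f "at x"] frechet_derivative_at[of "\<lambda>x. f x $ i"]
  by (auto simp: has_derivative_cart_iff dest!: spec[of _ i] fun_cong[of _ _ h])

text \<open>The mean value theorem in direction \<open>v\<close> turns the second difference into a first difference of
  \<open>D\<^sub>v f\<close> in direction \<open>w\<close>, and differentiability of \<open>D\<^sub>v f\<close> at the single point \<open>u\<close> suffices to estimate
  that.\<close>

lemma second_difference_limit:
  fixes f :: "'a::real_normed_vector \<Rightarrow> real"
  assumes r: "r > 0" and f: "\<And>x. x \<in> ball u r \<Longrightarrow> (f has_derivative f' x) (at x)"
    and A: "((\<lambda>x. f' x v) has_derivative A) (at u)"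
  shows "((\<lambda>h. (f (u + h *\<^sub>R v + h *\<^sub>R w) - f (u + h *\<^sub>R v) - f (u + h *\<^sub>R w) + f u) / h\<^sup>2)
    \<longlongrightarrow> A w) (at_right 0)"
proof (rule tendstoI)
  fix \<epsilon> :: real assume \<epsilon>: "\<epsilon> > 0"
  define K where "K = norm v + norm w + 1"
  have K: "K > 0" by (simp add: K_def add_nonneg_pos)
  interpret A: bounded_linear A using A by (rule has_derivative_bounded_linear)
  obtain d where d: "d > 0" "\<And>y. norm (y - u) < d \<Longrightarrow>
      norm (f' y v - f' u v - A (y - u)) \<le> \<epsilon> / (3 * K) * norm (y - u)"
    using A[unfolded has_derivative_at_alt] \<epsilon> K
    by (metis divide_pos_pos mult_pos_pos zero_less_numeral)
  define b where "b = min d r / K"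
  have b: "b > 0" using d r K by (simp add: b_def)
  have "dist ((f (u + h *\<^sub>R v + h *\<^sub>R w) - f (u + h *\<^sub>R v) - f (u + h *\<^sub>R w) + f u) / h\<^sup>2) (A w) < \<epsilon>"
    if h: "0 < h" "h < b" for h
  proof -
    have hK: "h * K < d" "h * K < r" using h K by (auto simp: b_def field_simps)
    have small: "norm (s *\<^sub>R v + t *\<^sub>R w) \<le> h * K" if "0 \<le> s" "s \<le> h" "0 \<le> t" "t \<le> h" for s t
    proof -
      have "norm (s *\<^sub>R v + t *\<^sub>R w) \<le> s * norm v + t * norm w"
        using that norm_triangle_ineq[of "s *\<^sub>R v" "t *\<^sub>R w"] by simp
      also have "\<dots> \<le> h * norm v + h * norm w + h"
        using that h by (intro add_mono add_increasing2 mult_right_mono) auto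
      finally show ?thesis by (simp add: K_def algebra_simps)
    qed
    have in_ball: "u + s *\<^sub>R v + t *\<^sub>R w \<in> ball u r" if "0 \<le> s" "s \<le> h" "0 \<le> t" "t \<le> h" for s t
      using small[OF that] hK norm_minus_commute[of "s *\<^sub>R v" "- t *\<^sub>R w"]
      by (auto simp: dist_norm add.assoc norm_minus_cancel[of "s *\<^sub>R v + t *\<^sub>R w", symmetric]
          simp del: norm_minus_cancel)
    define \<phi> where "\<phi> s = f (u + s *\<^sub>R v + h *\<^sub>R w) - f (u + s *\<^sub>R v)" for s
    have line: "((\<lambda>s. f (u + s *\<^sub>R v + t *\<^sub>R w)) has_real_derivative f' (u + s *\<^sub>R v + t *\<^sub>R w) v) (at s)"
      if "0 \<le> s" "s \<le> h" "0 \<le> t" "t \<le> h" for s t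
    proof -
      let ?p = "u + s *\<^sub>R v + t *\<^sub>R w"
      note fp = f[OF in_ball[OF that]]
      have "((\<lambda>s. f (u + s *\<^sub>R v + t *\<^sub>R w)) has_derivative (\<lambda>a. f' ?p (a *\<^sub>R v))) (at s)"
        by (rule has_derivative_compose[where f = "\<lambda>s. u + s *\<^sub>R v + t *\<^sub>R w" and g = f, OF _ fp]) (auto intro!: derivative_eq_intros)
      moreover have "f' ?p (a *\<^sub>R v) = f' ?p v * a" for a
        using linear_cmul[OF has_derivative_linear[OF fp]] by simp
      ultimately show ?thesis by (simp add: has_field_derivative_def)
    qed
    have \<phi>': "(\<phi> has_real_derivative f' (u + s *\<^sub>R v + h *\<^sub>R w) v - f' (u + s *\<^sub>R v) v) (at s)"
      if "0 \<le> s" "s \<le> h" for s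
      unfolding \<phi>_def using line[OF that, of h] line[OF that, of 0] h
      by (intro DERIV_diff) auto
    from MVT2[OF h(1) \<phi>'] obtain \<xi> where \<xi>: "0 < \<xi>" "\<xi> < h"
      "\<phi> h - \<phi> 0 = (h - 0) * (f' (u + \<xi> *\<^sub>R v + h *\<^sub>R w) v - f' (u + \<xi> *\<^sub>R v) v)"
      by auto
    have near: "norm (f' (u + \<xi> *\<^sub>R v + t *\<^sub>R w) v - f' u v - A (\<xi> *\<^sub>R v + t *\<^sub>R w)) \<le> \<epsilon> / (3 * K) * (h * K)"
      if "0 \<le> t" "t \<le> h" for t
    proof -
      have le: "norm (\<xi> *\<^sub>R v + t *\<^sub>R w) \<le> h * K" using small \<xi> that by auto
      then have "norm (f' (u + \<xi> *\<^sub>R v + t *\<^sub>R w) v - f' u v - A (\<xi> *\<^sub>R v + t *\<^sub>R w))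
          \<le> \<epsilon> / (3 * K) * norm (\<xi> *\<^sub>R v + t *\<^sub>R w)"
        using d(2)[of "u + \<xi> *\<^sub>R v + t *\<^sub>R w"] hK by (simp add: add.assoc)
      also have "\<dots> \<le> \<epsilon> / (3 * K) * (h * K)"
        using \<epsilon> K le by (intro mult_left_mono) auto
      finally show ?thesis .
    qed
    have "\<bar>f' (u + \<xi> *\<^sub>R v + h *\<^sub>R w) v - f' (u + \<xi> *\<^sub>R v) v - h * A w\<bar> \<le> 2 * (\<epsilon> / (3 * K) * (h * K))"
      using near[of h] near[of 0] h by (simp add: A.add A.scaleR)
    also have "\<dots> < \<epsilon> * h" using \<epsilon> K h by simp
    finally have *: "\<bar>f' (u + \<xi> *\<^sub>R v + h *\<^sub>R w) v - f' (u + \<xi> *\<^sub>R v) v - h * A w\<bar> < \<epsilon> * h" .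
    have num: "f (u + h *\<^sub>R v + h *\<^sub>R w) - f (u + h *\<^sub>R v) - f (u + h *\<^sub>R w) + f u
        = h * (f' (u + \<xi> *\<^sub>R v + h *\<^sub>R w) v - f' (u + \<xi> *\<^sub>R v) v)"
      using \<xi>(3) by (simp add: \<phi>_def)
    have "(f (u + h *\<^sub>R v + h *\<^sub>R w) - f (u + h *\<^sub>R v) - f (u + h *\<^sub>R w) + f u) / h\<^sup>2 - A w
        = (f' (u + \<xi> *\<^sub>R v + h *\<^sub>R w) v - f' (u + \<xi> *\<^sub>R v) v - h * A w) / h"
      unfolding num using h by (simp add: power2_eq_square diff_divide_distrib)
    then show ?thesis
      using * h by (simp add: dist_real_def abs_divide divide_less_eq)
  qed
  then show "\<forall>\<^sub>F h in at_right 0. dist ((f (u + h *\<^sub>R v + h *\<^sub>R w) - f (u + h *\<^sub>R v)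
      - f (u + h *\<^sub>R w) + f u) / h\<^sup>2) (A w) < \<epsilon>"
    using b by (auto simp: eventually_at_right_field)
qed

text \<open>The second difference is symmetric in \<open>v\<close> and \<open>w\<close>, and its limit is unique.\<close>

theorem second_derivative_symmetric:
  fixes f :: "'a::real_normed_vector \<Rightarrow> real"
  assumes S: "open S" "u \<in> S" and f: "\<And>x. x \<in> S \<Longrightarrow> (f has_derivative f' x) (at x)"
    and A: "((\<lambda>x. f' x v) has_derivative A) (at u)" and B: "((\<lambda>x. f' x w) has_derivative B) (at u)"
  shows "A w = B v"
proof -
  obtain r where r: "r > 0" "ball u r \<subseteq> S" using S by (meson open_contains_ball)
  have "((\<lambda>h. (f (u + h *\<^sub>R v + h *\<^sub>R w) - f (u + h *\<^sub>R v) - f (u + h *\<^sub>R w) + f u) / h\<^sup>2)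
      \<longlongrightarrow> A w) (at_right 0)"
    using r f A by (intro second_difference_limit) auto
  moreover have "((\<lambda>h. (f (u + h *\<^sub>R w + h *\<^sub>R v) - f (u + h *\<^sub>R w) - f (u + h *\<^sub>R v) + f u) / h\<^sup>2)
      \<longlongrightarrow> B v) (at_right 0)"
    using r f B by (intro second_difference_limit) auto
  ultimately show ?thesis
    using tendsto_unique[of "at_right (0::real)"] by (simp add: algebra_simps)
qed

lemma pd_commute:
  fixes f :: "real^'d::finite \<Rightarrow> real"
  assumes S: "open S" "u \<in> S" and f: "f differentiable_on S"
    and i: "pd i f differentiable (at u)" and k: "pd k f differentiable (at u)"
  shows "pd k (pd i f) u = pd i (pd k f) u"
proof -
  have d: "(f has_derivative frechet_derivative f (at x)) (at x)" if "x \<in> S" for x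
    using f S that by (auto simp: differentiable_on_eq_differentiable_at frechet_derivative_works)
  have p: "((\<lambda>x. frechet_derivative f (at x) (axis j 1)) has_derivative frechet_derivative (pd j f) (at u)) (at u)"
    if "pd j f differentiable (at u)" for j
    using that by (simp add: frechet_derivative_works pd_def[abs_def])
  show ?thesis
    using second_derivative_symmetric[OF S d p[OF i] p[OF k]] by (simp add: pd_def)
qed

lemma pd_eqI:
  assumes "(f has_derivative f') (at x)"
  shows "pd k f x = f' (axis k 1)"
  using frechet_derivative_at[OF assms] by (simp add: pd_def)

lemma smooth_on_imp_differentiable_on: "smooth_on S f \<Longrightarrow> f differentiable_on S"
  unfolding smooth_on_def by (drule spec[of _ "Suc 0"]) simp

lemma smooth_on_pd: "smooth_on S f \<Longrightarrow> smooth_on S (pd k f)"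
proof -
  assume "smooth_on S f"
  then have "Ck_on (Suc n) S f" for n by (simp add: smooth_on_def)
  then have "Ck_on n S (\<lambda>x. frechet_derivative f (at x) (axis k 1))" for n by simp
  then show ?thesis by (simp add: smooth_on_def pd_def[abs_def])
qed

section \<open>Symmetries implied by the energy structure\<close>

locale energy_structure_on =
  fixes \<U> :: "(real^'m::finite) set" and F :: "'d::finite \<Rightarrow> real^'m \<Rightarrow> real^'m" and e g G \<Delta>A cH CH
  assumes energy: "energy_structure \<U> F e g G \<Delta>A cH CH"
begin

lemma open_dom: "open \<U>" using energy by (simp add: energy_structure_def)

lemma smooth_e: "smooth_on \<U> e" using energy by (simp add: energy_structure_def)

lemma smooth_imp_differentiable:
  "smooth_on \<U> f \<Longrightarrow> u \<in> \<U> \<Longrightarrow> f differentiable (at u)"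
  using smooth_on_imp_differentiable_on differentiable_on_eq_differentiable_at[OF open_dom] by blast

lemma hess_entry:
  assumes "u \<in> \<U>"
  shows "hess e u $ i $ j = pd j (pd i e) u"
proof -
  have "pd i e differentiable (at u)" for i
    using smooth_imp_differentiable[OF smooth_on_pd[OF smooth_e] assms] .
  then have "grad e differentiable (at u)"
    by (simp add: differentiable_cart_iff grad_def)
  then show ?thesis
    unfolding hess_def jacobian_def matrix_def
    by (simp add: frechet_derivative_cart) (simp add: grad_def pd_def[abs_def])
qed

lemma hess_entry_sym:
  assumes "u \<in> \<U>"
  shows "hess e u $ i $ j = hess e u $ j $ i"
  unfolding hess_entry[OF assms]
  by (intro pd_commute[OF open_dom assms] smooth_on_imp_differentiable_on
      smooth_imp_differentiable[OF _ assms] smooth_on_pd smooth_e)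

text \<open>The gradient of \<open>\<psi> = \<nabla>e \<bullet> F\<^sub>k - g\<^sub>k\<close> is \<open>(Hess e) F\<^sub>k\<close>: the remaining terms
  \<open>\<nabla>e\<^sup>T A\<^sub>k - \<nabla>g\<^sub>k\<^sup>T\<close> vanish.  The derivative of this gradient consists of a
  contraction of the third derivative of \<open>e\<close> with \<open>F\<^sub>k\<close> and of \<open>(Hess e) A\<^sub>k\<close>; it is symmetric as a second
  derivative, and so is the first term.\<close>

lemma hess_flux_symmetric:
  assumes u: "u \<in> \<U>"
  shows "sym_mat (hess e u ** Amat F k u)"
proof -
  define h where "h i j = pd i (pd j e)" for i j
  have he: "hess e x $ i $ j = h i j x" if "x \<in> \<U>" for x i j
    using hess_entry_sym[OF that, of i j] hess_entry[OF that, of j i] by (simp add: h_def)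
  have smooth_p: "smooth_on \<U> (pd j e)" and smooth_h: "smooth_on \<U> (h i j)" for i j
    unfolding h_def by (intro smooth_on_pd smooth_e)+
  have Fd: "F k differentiable (at x)" if "x \<in> \<U>" for x
    using energy that open_dom differentiable_on_eq_differentiable_at
    by (auto simp: energy_structure_def)
  have Fj: "(\<lambda>x. F k x $ j) differentiable (at x)" if "x \<in> \<U>" for x j
    using Fd[OF that] by (simp add: differentiable_cart_iff)
  have A: "Amat F k x $ j $ i = pd i (\<lambda>y. F k y $ j) x" if "x \<in> \<U>" for x i j
    using Fd[OF that] by (simp add: Amat_def jacobian_def matrix_def frechet_derivative_cart pd_def)
  have gd: "g k differentiable (at x)" if "x \<in> \<U>" for x
    using energy smooth_imp_differentiable that by (auto simp: energy_structure_def)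
  have flux: "pd i (g k) x = (\<Sum>j\<in>UNIV. pd j e x * pd i (\<lambda>y. F k y $ j) x)" if "x \<in> \<U>" for x i
  proof -
    have "grad e x v* Amat F k x = grad (g k) x"
      using energy that by (simp add: energy_structure_def)
    then have "(grad e x v* Amat F k x) $ i = grad (g k) x $ i" by simp
    then show ?thesis
      by (simp add: vector_matrix_mult_def grad_def A[OF that] mult.commute)
  qed
  define \<psi> where "\<psi> x = (\<Sum>j\<in>UNIV. pd j e x * F k x $ j) - g k x" for x
  have diff: "(f has_derivative frechet_derivative f (at x)) (at x)" if "f differentiable (at x)"
    for f :: "real^'m \<Rightarrow> real" and x
    using that frechet_derivative_works by blast
  have \<psi>': "(\<psi> has_derivative (\<lambda>z. (\<Sum>j\<in>UNIV. pd j e x * frechet_derivative (\<lambda>y. F k y $ j) (at x) z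
      + frechet_derivative (pd j e) (at x) z * F k x $ j) - frechet_derivative (g k) (at x) z)) (at x)"
    if "x \<in> \<U>" for x
    unfolding \<psi>_def
    by (intro has_derivative_diff has_derivative_sum has_derivative_mult diff gd Fj that
        smooth_imp_differentiable smooth_p)
  have \<psi>_pd: "pd i \<psi> x = (\<Sum>j\<in>UNIV. h i j x * F k x $ j)" if "x \<in> \<U>" for x i
    using pd_eqI[OF \<psi>'[OF that], of i] flux[OF that, of i]
    by (simp add: sum.distrib pd_def h_def)
  have \<psi>_pd_deriv: "((\<lambda>x. \<Sum>j\<in>UNIV. h i j x * F k x $ j) has_derivative
      (\<lambda>z. \<Sum>j\<in>UNIV. h i j u * frechet_derivative (\<lambda>y. F k y $ j) (at u) z
        + frechet_derivative (h i j) (at u) z * F k u $ j)) (at u)" for i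
    by (intro has_derivative_sum has_derivative_mult diff Fj u smooth_imp_differentiable smooth_h)
  have \<psi>_pd_diff: "(pd i \<psi> has_derivative
      (\<lambda>z. \<Sum>j\<in>UNIV. h i j u * frechet_derivative (\<lambda>y. F k y $ j) (at u) z
        + frechet_derivative (h i j) (at u) z * F k u $ j)) (at u)" for i
    using has_derivative_transform_within_open[OF \<psi>_pd_deriv open_dom u] \<psi>_pd by simp
  have "pd l (pd i \<psi>) u = pd i (pd l \<psi>) u" for i l
    using open_dom u
  proof (rule pd_commute)
    show "\<psi> differentiable_on \<U>"
      using \<psi>' open_dom by (auto simp: differentiable_on_eq_differentiable_at differentiable_def)
  qed (use \<psi>_pd_diff in \<open>auto simp: differentiable_def\<close>)
  then have key: "(\<Sum>j\<in>UNIV. h i j u * pd l (\<lambda>y. F k y $ j) u + pd l (h i j) u * F k u $ j)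
      = (\<Sum>j\<in>UNIV. h l j u * pd i (\<lambda>y. F k y $ j) u + pd i (h l j) u * F k u $ j)" for i l
    using pd_eqI[OF \<psi>_pd_diff] by (simp add: pd_def)
  have third: "pd l (h i j) u = pd i (h l j) u" for i j l
    unfolding h_def
    by (intro pd_commute[OF open_dom u] smooth_on_imp_differentiable_on
        smooth_imp_differentiable[OF _ u] smooth_on_pd smooth_p)
  have "(\<Sum>j\<in>UNIV. h i j u * pd l (\<lambda>y. F k y $ j) u) = (\<Sum>j\<in>UNIV. h l j u * pd i (\<lambda>y. F k y $ j) u)" for i l
    using key[of i l] by (simp add: sum.distrib third[of l i])
  then show ?thesis
    by (simp add: sym_mat_def vec_eq_iff transpose_def matrix_matrix_mult_def he[OF u] A[OF u])
qed

lemma sym_hess: "u \<in> \<U> \<Longrightarrow> sym_mat (hess e u)"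
  by (simp add: sym_mat_def vec_eq_iff transpose_def hess_entry_sym)

lemma sym_mat_scaleR: "sym_mat X \<Longrightarrow> sym_mat (c *\<^sub>R X)"
  by (simp add: sym_mat_def transpose_scalar)

lemma sym_Hmat: "u \<in> \<U> \<Longrightarrow> sym_mat (Hmat e u)"
  unfolding Hmat_def by (intro sym_mat_scaleR sym_hess)

lemma sym_Hmat_Amat: "u \<in> \<U> \<Longrightarrow> sym_mat (Hmat e u ** Amat F k u)"
  unfolding Hmat_def scalar_matrix_assoc[symmetric]
  by (intro sym_mat_scaleR hess_flux_symmetric)

text \<open>\<open>H \<Delta>A\<^sub>k\<close> is the difference of the symmetric matrices \<open>G\<^sub>k\<close> and \<open>H A\<^sub>k\<close>.\<close>

lemma sym_Hmat_DeltaA: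
  assumes "u \<in> \<U>"
  shows "sym_mat (Hmat e u ** \<Delta>A k u)"
proof -
  have "G k u = Hmat e u ** (Amat F k u + \<Delta>A k u)" "sym_mat (G k u)"
    using energy assms unfolding energy_structure_def by blast+
  then have "G k u = Hmat e u ** Amat F k u + Hmat e u ** \<Delta>A k u" "sym_mat (G k u)"
    by (simp_all only: matrix_add_ldistrib)
  then have "Hmat e u ** \<Delta>A k u = G k u - Hmat e u ** Amat F k u" "sym_mat (G k u)" by simp_all
  then show ?thesis
    using sym_Hmat_Amat[OF assms, of k]
    by (simp add: sym_mat_def vec_eq_iff transpose_def)
qed

text \<open>At the origin the quotient in the definition of \<open>H\<close> has denominator zero, hence value zero, and the
  zero matrix violates the positive lower eigenvalue bound.  Thus the denominator is nonzero on the whole admissible set.\<close>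

lemma zero_notin_dom: "0 \<notin> \<U>"
proof
  assume 0: "0 \<in> \<U>"
  have "eigenvalue (Hmat e 0) 0"
    unfolding eigenvalue_def
    by (intro exI[of _ "axis undefined 1"]) (simp add: Hmat_def axis_eq_0_iff)
  moreover have "0 < cH" "\<And>l. eigenvalue (Hmat e 0) l \<Longrightarrow> cH \<le> l"
    using energy 0 unfolding energy_structure_def by blast+
  ultimately show False by force
qed

lemma Hmat_differentiable:
  assumes u: "u \<in> \<U>"
  shows "Hmat e differentiable (at u)"
proof -
  have hij: "(\<lambda>x. hess e x $ i $ j) differentiable (at u)" for i j
  proof -
    have "pd j (pd i e) differentiable (at u)"
      using smooth_e smooth_on_pd smooth_imp_differentiable u by blast
    then obtain D where D: "(pd j (pd i e) has_derivative D) (at u)" by (auto simp: differentiable_def)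
    have "((\<lambda>x. hess e x $ i $ j) has_derivative D) (at u)"
      by (rule has_derivative_transform_within_open[OF D open_dom u]) (simp add: hess_entry)
    then show ?thesis by (auto simp: differentiable_def)
  qed
  have q: "x \<bullet> (hess e x *v x) = (\<Sum>i\<in>UNIV. \<Sum>j\<in>UNIV. x $ i * (hess e x $ i $ j * x $ j))" for x
    by (simp add: inner_vec_def matrix_vector_mult_def sum_distrib_left)
  have xi: "(\<lambda>x::real^'m. x $ i) differentiable (at u)" for i
    by (intro bounded_linear_imp_differentiable) (rule bounded_linear_vec_nth)
  have "u \<noteq> 0" using u zero_notin_dom by auto
  moreover have "spd (hess e u)"
    using energy u unfolding energy_structure_def by blast
  ultimately have "u \<bullet> (hess e u *v u) > 0" by (simp add: spd_def)
  then have nz: "(\<Sum>i\<in>UNIV. \<Sum>j\<in>UNIV. u $ i * (hess e u $ i $ j * u $ j)) \<noteq> 0"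
    unfolding q by simp
  have "(\<lambda>x. Hmat e x $ i $ j) differentiable (at u)" for i j
    unfolding Hmat_def q vector_scaleR_component real_scaleR_def
    by (intro differentiable_mult differentiable_divide differentiable_sum differentiable_const hij xi
        smooth_imp_differentiable smooth_e u nz finite ballI)
  then show ?thesis by (simp add: differentiable_cart_iff)
qed

lemma sym_Hmat_derivative:
  assumes u: "u \<in> \<U>"
  shows "sym_mat (frechet_derivative (Hmat e) (at u) z)"
proof -
  have H: "Hmat e differentiable (at u)" by (rule Hmat_differentiable[OF u])
  then have Hi: "(\<lambda>x. Hmat e x $ i) differentiable (at u)" for i
    by (simp add: differentiable_cart_iff)
  then have Hij: "(\<lambda>x. Hmat e x $ i $ j) differentiable (at u)" for i j
    by (simp add: differentiable_cart_iff)
  have entry: "frechet_derivative (Hmat e) (at u) z $ i $ j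
      = frechet_derivative (\<lambda>x. Hmat e x $ i $ j) (at u) z" for i j
    using H Hi by (simp add: frechet_derivative_cart)
  have "Hmat e x $ i $ j = Hmat e x $ j $ i" if "x \<in> \<U>" for x i j
    using sym_Hmat[OF that] by (simp add: sym_mat_def vec_eq_iff transpose_def)
  then have "frechet_derivative (\<lambda>x. Hmat e x $ i $ j) (at u)
      = frechet_derivative (\<lambda>x. Hmat e x $ j $ i) (at u)" for i j
    by (intro frechet_derivative_transform_within_open[OF Hij open_dom u])
  then show ?thesis
    by (simp add: sym_mat_def vec_eq_iff transpose_def entry)
qed

end

section \<open>Polynomials and discrete projection\<close>

definition monomial :: "('d::finite \<Rightarrow> nat) \<Rightarrow> real^'d \<Rightarrow> real" where
  "monomial a x = (\<Prod>k\<in>UNIV. x $ k ^ a k)"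

lemma finite_exponents: "finite {a :: 'd::finite \<Rightarrow> nat. sum a UNIV \<le> p}"
proof (rule finite_subset)
  show "{a :: 'd \<Rightarrow> nat. sum a UNIV \<le> p} \<subseteq> (UNIV \<rightarrow>\<^sub>E {..p})"
  proof
    fix a :: "'d \<Rightarrow> nat" assume "a \<in> {a. sum a UNIV \<le> p}"
    moreover have "a k \<le> sum a UNIV" for k by (rule member_le_sum) auto
    ultimately show "a \<in> UNIV \<rightarrow>\<^sub>E {..p}" by (auto intro: order_trans)
  qed
  show "finite ((UNIV :: 'd set) \<rightarrow>\<^sub>E {..p})"
    by (intro finite_PiE) auto
qed

lemma Polys_iff: "f \<in> Polys p \<longleftrightarrow> (\<exists>c. f = (\<lambda>x. \<Sum>a | sum a UNIV \<le> p. c a * monomial a x))"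
  by (simp add: Polys_def monomial_def)

lemma PolysE:
  assumes "f \<in> Polys p"
  obtains c where "\<And>x. f x = (\<Sum>a | sum a UNIV \<le> p. c a * monomial a x)"
  using assms by (auto simp: Polys_iff)

lemma Polys_monomial: "sum a UNIV \<le> p \<Longrightarrow> monomial a \<in> Polys p"
  unfolding Polys_iff
  by (intro exI[of _ "\<lambda>b. if b = a then 1 else 0"])
     (rule ext, simp add: finite_exponents if_distrib[of "\<lambda>z. z * _"] cong: if_cong)

lemma Polys_zero: "(\<lambda>x. 0) \<in> Polys p"
  unfolding Polys_iff by (intro exI[of _ "\<lambda>_. 0"]) simp

lemma Polys_add: "f \<in> Polys p \<Longrightarrow> g \<in> Polys p \<Longrightarrow> (\<lambda>x. f x + g x) \<in> Polys p"
proof -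
  assume "f \<in> Polys p" "g \<in> Polys p"
  then obtain c d where "\<And>x. f x = (\<Sum>a | sum a UNIV \<le> p. c a * monomial a x)"
    "\<And>x. g x = (\<Sum>a | sum a UNIV \<le> p. d a * monomial a x)"
    by (auto elim!: PolysE)
  then show ?thesis
    unfolding Polys_iff
    by (intro exI[of _ "\<lambda>a. c a + d a"]) (simp add: fun_eq_iff sum.distrib distrib_right)
qed

lemma Polys_cmult: "f \<in> Polys p \<Longrightarrow> (\<lambda>x. r * f x) \<in> Polys p"
proof -
  assume "f \<in> Polys p"
  then obtain c where "\<And>x. f x = (\<Sum>a | sum a UNIV \<le> p. c a * monomial a x)"
    by (auto elim!: PolysE)
  then show ?thesis
    unfolding Polys_iff
    by (intro exI[of _ "\<lambda>a. r * c a"]) (simp add: fun_eq_iff sum_distrib_left mult.assoc)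
qed

lemma Polys_sum: "finite I \<Longrightarrow> (\<And>i. i \<in> I \<Longrightarrow> f i \<in> Polys p) \<Longrightarrow> (\<lambda>x. \<Sum>i\<in>I. f i x) \<in> Polys p"
  by (induction I rule: finite_induct) (auto intro: Polys_zero Polys_add)

lemma Polys_combination:
  "finite I \<Longrightarrow> (\<And>a. a \<in> I \<Longrightarrow> c a \<noteq> 0 \<Longrightarrow> f a \<in> Polys p) \<Longrightarrow> (\<lambda>x. \<Sum>a\<in>I. c a * f a x) \<in> Polys p"
proof (rule Polys_sum)
  fix a assume "\<And>a. a \<in> I \<Longrightarrow> c a \<noteq> 0 \<Longrightarrow> f a \<in> Polys p" "a \<in> I"
  then show "(\<lambda>x. c a * f a x) \<in> Polys p"
    by (cases "c a = 0") (auto intro: Polys_zero Polys_cmult)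
qed

lemma Polys_mono: "p \<le> q \<Longrightarrow> f \<in> Polys p \<Longrightarrow> f \<in> Polys q"
proof -
  assume "p \<le> q" "f \<in> Polys p"
  then obtain c where "f = (\<lambda>x. \<Sum>a | sum a UNIV \<le> p. c a * monomial a x)"
    by (auto simp: Polys_iff)
  with \<open>p \<le> q\<close> show ?thesis
    by (auto intro!: Polys_combination finite_exponents Polys_monomial)
qed

lemma monomial_add: "monomial a x * monomial b x = monomial (\<lambda>k. a k + b k) x"
  by (simp add: monomial_def power_add prod.distrib)

lemma Polys_mult:
  assumes "f \<in> Polys p" "g \<in> Polys q"
  shows "(\<lambda>x. f x * g x) \<in> Polys (p + q)"
proof -
  obtain c d where "\<And>x. f x = (\<Sum>a | sum a UNIV \<le> p. c a * monomial a x)"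
    "\<And>x. g x = (\<Sum>a | sum a UNIV \<le> q. d a * monomial a x)"
    using assms by (auto elim!: PolysE)
  then have "(\<lambda>x. f x * g x) = (\<lambda>x. \<Sum>a | sum a UNIV \<le> p. c a *
      (\<Sum>b | sum b UNIV \<le> q. d b * monomial (\<lambda>k. a k + b k) x))"
    by (intro ext) (simp add: sum_distrib_right, simp add: sum_distrib_left monomial_add[symmetric] mult_ac)
  also have "\<dots> \<in> Polys (p + q)"
    by (intro Polys_combination finite_exponents Polys_monomial)
       (auto simp: sum.distrib intro!: add_mono)
  finally show ?thesis .
qed

lemma monomial_has_derivative:
  "(monomial a has_derivative (\<lambda>h. \<Sum>k\<in>UNIV. (real (a k) * monomial (a(k := a k - 1)) x) * h $ k)) (at x)"
proof -
  have nth: "((\<lambda>x::real^'d. x $ k) has_derivative (\<lambda>h. h $ k)) (at x)" for k x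
    by (rule bounded_linear_imp_has_derivative[OF bounded_linear_vec_nth])
  have "((\<lambda>x. \<Prod>k\<in>UNIV. x $ k ^ a k) has_derivative
      (\<lambda>h. \<Sum>k\<in>UNIV. (of_nat (a k) * h $ k * (x $ k) ^ (a k - 1)) * (\<Prod>j\<in>UNIV - {k}. x $ j ^ a j))) (at x)"
    by (intro has_derivative_prod has_derivative_power nth)
  moreover have "(\<Prod>j\<in>UNIV. x $ j ^ (a(k := a k - 1)) j) = (x $ k) ^ (a k - 1) * (\<Prod>j\<in>UNIV - {k}. x $ j ^ a j)" for k
    by (subst prod.remove[of UNIV k]) auto
  ultimately show ?thesis
    unfolding monomial_def[abs_def] by (simp add: mult_ac)
qed

lemma Polys_differentiable:
  assumes "f \<in> Polys p"
  shows "f differentiable (at x)"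
proof -
  obtain c where "f = (\<lambda>x. \<Sum>a | sum a UNIV \<le> p. c a * monomial a x)"
    using assms by (auto simp: Polys_iff)
  moreover have "monomial a differentiable (at x)" for a :: "'a \<Rightarrow> nat"
    using monomial_has_derivative by (auto simp: differentiable_def)
  ultimately show ?thesis
    using finite_exponents by (auto intro!: differentiable_sum differentiable_mult)
qed

text \<open>The truncated subtraction is correct also for \<open>p = 0\<close>, since then the derivative vanishes.\<close>

lemma Polys_pd_mult:
  fixes f g :: "real^'d::finite \<Rightarrow> real"
  assumes f: "f \<in> Polys p" and g: "g \<in> Polys q"
  shows "(\<lambda>x. g x * pd k f x) \<in> Polys (p + q - 1)"
proof -
  obtain c where c: "f = (\<lambda>x. \<Sum>a | sum a UNIV \<le> p. c a * monomial a x)"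
    using assms by (auto simp: Polys_iff)
  have pd_f: "pd k f x = (\<Sum>a | sum a UNIV \<le> p. c a * (real (a k) * monomial (a(k := a k - 1)) x))" for x
  proof -
    have "(f has_derivative (\<lambda>h. \<Sum>a | sum a UNIV \<le> p. c a *
        (\<Sum>k\<in>UNIV. (real (a k) * monomial (a(k := a k - 1)) x) * h $ k))) (at x)"
      unfolding c by (intro has_derivative_sum has_derivative_mult_right monomial_has_derivative)
    from pd_eqI[OF this, of k] show ?thesis
      by (simp add: axis_def if_distrib cong: if_cong)
  qed
  have "(\<lambda>x. g x * pd k f x) = (\<lambda>x. \<Sum>a | sum a UNIV \<le> p. (c a * real (a k)) *
      (g x * monomial (a(k := a k - 1)) x))"
    by (simp add: fun_eq_iff pd_f sum_distrib_left mult_ac)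
  also have "\<dots> \<in> Polys (p + q - 1)"
  proof (intro Polys_combination finite_exponents)
    fix a assume a: "a \<in> {a. sum a UNIV \<le> p}" and nz: "c a * real (a k) \<noteq> 0"
    have "sum (a(k := a k - 1)) UNIV = (a k - 1) + sum a (UNIV - {k})"
      by (subst sum.remove[of UNIV k]) auto
    moreover have "sum a UNIV = a k + sum a (UNIV - {k})"
      by (subst sum.remove[of UNIV k]) auto
    ultimately have deg: "sum (a(k := a k - 1)) UNIV \<le> p - 1" and p: "p \<ge> 1"
      using a nz by auto
    have "(\<lambda>x. g x * monomial (a(k := a k - 1)) x) \<in> Polys (q + (p - 1))"
      by (intro Polys_mult g Polys_monomial deg)
    then show "(\<lambda>x. g x * monomial (a(k := a k - 1)) x) \<in> Polys (p + q - 1)"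
      using p by (simp add: algebra_simps)
  qed
  finally show ?thesis .
qed

lemma Polys_continuous: "f \<in> Polys p \<Longrightarrow> continuous_on UNIV f"
  using Polys_differentiable differentiable_imp_continuous_within
  by (fastforce simp: continuous_on_eq_continuous_within)

lemma quad_add: "quad q (\<lambda>x. f x + g x) = quad q f + quad q g"
  by (simp add: quad_def scaleR_add_right sum.distrib)

lemma quad_diff: "quad q (\<lambda>x. f x - g x :: real) = quad q f - quad q g"
  by (simp add: quad_def sum_subtractf algebra_simps)

lemma quad_cmult: "quad q (\<lambda>x. c * f x :: real) = c * quad q f"
  by (simp add: quad_def sum_distrib_left mult_ac)

lemma quad_sum: "quad q (\<lambda>x. \<Sum>i\<in>I. f i x) = (\<Sum>i\<in>I. quad q (f i))"
  unfolding quad_def scaleR_sum_right by (rule sum.swap)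

lemma quad_cong: "(\<And>x. x \<in> fst q \<Longrightarrow> f x = g x) \<Longrightarrow> quad q f = quad q g"
  by (simp add: quad_def)

text \<open>Gram-Schmidt for the discrete inner product, which may be degenerate.  The new basis function is replaced
  by its residual \<open>r\<close>; if \<open>r\<close> has discrete norm zero, it vanishes at all nodes and no correction is
  required.\<close>

lemma discrete_best_approximation_span:
  fixes b :: "'i \<Rightarrow> real^'d::finite \<Rightarrow> real"
  assumes q: "finite (fst q)" "\<And>x. x \<in> fst q \<Longrightarrow> snd q x > 0" and "finite A"
  shows "\<exists>c. \<forall>a\<in>A. quad q (\<lambda>x. (f x - (\<Sum>i\<in>A. c i * b i x)) * b a x) = 0"
  using \<open>finite A\<close>
proof (induction A arbitrary: f rule: finite_induct)
  case empty
  show ?case by simp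
next
  case (insert j A)
  obtain d where d: "\<And>a. a \<in> A \<Longrightarrow> quad q (\<lambda>x. (b j x - (\<Sum>i\<in>A. d i * b i x)) * b a x) = 0"
    using insert.IH[of "b j"] by auto
  obtain c where c: "\<And>a. a \<in> A \<Longrightarrow> quad q (\<lambda>x. (f x - (\<Sum>i\<in>A. c i * b i x)) * b a x) = 0"
    using insert.IH[of f] by auto
  define r where "r x = b j x - (\<Sum>i\<in>A. d i * b i x)" for x
  define s where "s x = f x - (\<Sum>i\<in>A. c i * b i x)" for x
  have rA: "quad q (\<lambda>x. r x * b a x) = 0" and sA: "quad q (\<lambda>x. s x * b a x) = 0" if "a \<in> A" for a
    using d[OF that] c[OF that] by (simp_all add: r_def s_def)
  define t where "t = quad q (\<lambda>x. s x * b j x) / quad q (\<lambda>x. r x * b j x)"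
  have rr: "quad q (\<lambda>x. r x * b j x) = quad q (\<lambda>x. r x * r x)"
  proof -
    have "quad q (\<lambda>x. r x * b j x) = quad q (\<lambda>x. r x * r x + (\<Sum>i\<in>A. d i * (r x * b i x)))"
    proof (intro quad_cong)
      fix x
      have bj: "b j x = r x + (\<Sum>i\<in>A. d i * b i x)" by (simp add: r_def)
      show "r x * b j x = r x * r x + (\<Sum>i\<in>A. d i * (r x * b i x))"
        unfolding bj by (simp add: distrib_left sum_distrib_left mult_ac)
    qed
    then show ?thesis by (simp add: quad_add quad_sum quad_cmult rA)
  qed
  have sj: "quad q (\<lambda>x. s x * b j x) = t * quad q (\<lambda>x. r x * b j x)"
  proof (cases "quad q (\<lambda>x. r x * b j x) = 0")
    case True
    then have "(\<Sum>x\<in>fst q. snd q x * (r x * r x)) = 0" by (simp add: rr) (simp add: quad_def)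
    moreover have "0 \<le> snd q x * (r x * r x)" if "x \<in> fst q" for x
      using q(2)[OF that] by simp
    ultimately have "\<forall>x\<in>fst q. snd q x * (r x * r x) = 0"
      using sum_nonneg_eq_0_iff[OF q(1), of "\<lambda>x. snd q x * (r x * r x)"] by blast
    then have r0: "r x = 0" if "x \<in> fst q" for x using q(2)[OF that] that by auto
    have "quad q (\<lambda>x. s x * b j x) = quad q (\<lambda>x. \<Sum>i\<in>A. d i * (s x * b i x))"
    proof (intro quad_cong)
      fix x assume "x \<in> fst q"
      then have "b j x = (\<Sum>i\<in>A. d i * b i x)" using r0[of x] by (simp add: r_def)
      then show "s x * b j x = (\<Sum>i\<in>A. d i * (s x * b i x))"
        by (simp add: sum_distrib_left mult_ac)
    qed
    then show ?thesis using True by (simp add: quad_sum quad_cmult sA)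
  qed (simp add: t_def)
  \<comment> \<open>subtract \<open>t\<close> times the residual of \<open>b j\<close>, expressed in the original functions\<close>
  define c' where "c' i = (if i = j then t else c i - t * d i)" for i
  have comb: "f x - (\<Sum>i\<in>insert j A. c' i * b i x) = s x - t * r x" for x
  proof -
    have "(\<Sum>i\<in>insert j A. c' i * b i x) = t * b j x + (\<Sum>i\<in>A. (c i - t * d i) * b i x)"
      using insert.hyps by (auto simp: c'_def intro!: sum.cong)
    then show ?thesis
      by (simp add: s_def r_def algebra_simps sum_subtractf sum_distrib_left)
  qed
  have "quad q (\<lambda>x. (s x - t * r x) * b a x) = 0" if "a \<in> insert j A" for a
  proof -
    have "quad q (\<lambda>x. (s x - t * r x) * b a x) = quad q (\<lambda>x. s x * b a x - t * (r x * b a x))"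
      by (intro quad_cong) (simp add: algebra_simps)
    also have "\<dots> = quad q (\<lambda>x. s x * b a x) - t * quad q (\<lambda>x. r x * b a x)"
      by (simp add: quad_diff quad_cmult)
    finally show ?thesis using that rA sA sj by auto
  qed
  then show ?case unfolding comb[symmetric] by blast
qed

lemma disc_proj_in_Polys:
  assumes q: "finite (fst q)" "\<And>x. x \<in> fst q \<Longrightarrow> snd q x > 0"
  shows "disc_proj q r f \<in> Polys r"
proof -
  let ?A = "{a. sum a UNIV \<le> r}"
  obtain c where c: "\<And>a. a \<in> ?A \<Longrightarrow> quad q (\<lambda>x. (f x - (\<Sum>i\<in>?A. c i * monomial i x)) * monomial a x) = 0"
    using discrete_best_approximation_span[OF q finite_exponents, where f = f and b = monomial] by blast
  define v where "v x = (\<Sum>i\<in>?A. c i * monomial i x)" for x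
  have "v \<in> Polys r" by (auto simp: Polys_iff v_def[abs_def])
  moreover have "quad q (\<lambda>x. v x * w x) = quad q (\<lambda>x. f x * w x)" if w: "w \<in> Polys r" for w
  proof -
    obtain d where "\<And>x. w x = (\<Sum>a\<in>?A. d a * monomial a x)"
      using w by (auto elim!: PolysE)
    then have "quad q (\<lambda>x. f x * w x - v x * w x)
        = quad q (\<lambda>x. \<Sum>a\<in>?A. d a * ((f x - v x) * monomial a x))"
      by (intro quad_cong) (simp add: sum_distrib_left sum_subtractf algebra_simps)
    also have "\<dots> = 0" using c by (simp add: quad_sum quad_cmult v_def)
    finally show ?thesis by (simp add: quad_diff)
  qed
  ultimately show ?thesis
    unfolding disc_proj_def
    by (intro someI2_ex[where Q = "\<lambda>v. v \<in> Polys r"]) auto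
qed

lemma disc_proj_cong:
  assumes "\<And>x. x \<in> fst q \<Longrightarrow> f x = g x"
  shows "disc_proj q r f = disc_proj q r g"
proof -
  have "quad q (\<lambda>x. f x * w x) = quad q (\<lambda>x. g x * w x)" for w
    using assms by (intro quad_cong) simp
  then show ?thesis by (simp add: disc_proj_def)
qed

section \<open>Differentiating a triangular factorization\<close>

lemma real_sqrt_differentiable:
  fixes f :: "real \<Rightarrow> real"
  assumes "f differentiable (at t)" "f t > 0"
  shows "(\<lambda>s. sqrt (f s)) differentiable (at t)"
proof -
  obtain D where "(f has_real_derivative D) (at t)"
    using assms(1) by (auto simp: real_differentiable_def)
  then have "((\<lambda>s. sqrt (f s)) has_real_derivative inverse (sqrt (f t)) / 2 * D) (at t)"
    using DERIV_chain2[of sqrt _ f t, OF DERIV_real_sqrt[OF assms(2)]] by blast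
  then show ?thesis by (auto simp: real_differentiable_def)
qed

lemma differentiable_cong_open:
  assumes "open T" "t \<in> T" "\<And>s. s \<in> T \<Longrightarrow> f s = g s" "f differentiable (at t)"
  shows "g differentiable (at t)"
proof -
  obtain D where D: "(f has_derivative D) (at t)"
    using assms(4) by (auto simp: differentiable_def)
  have "(g has_derivative D) (at t)"
    by (rule has_derivative_transform_within_open[OF D assms(1-3)])
  then show ?thesis by (auto simp: differentiable_def)
qed

lemma matrix_inv_cancel:
  assumes "invertible (R :: real^'n^'n)"
  shows "matrix_inv R ** R = mat 1" "R ** matrix_inv R = mat 1"
  using assms someI_ex[of "\<lambda>X. R ** X = mat 1 \<and> X ** R = mat 1"]
  by (auto simp: invertible_def matrix_inv_def)

lemma matrix_add_mult: "(A + B) ** C = A ** C + B ** (C :: real^'n^'m)"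
  by (simp add: vec_eq_iff matrix_matrix_mult_def distrib_right sum.distrib)

lemma has_vector_derivative_matrix_iff:
  fixes X :: "real \<Rightarrow> real^'n^'m"
  shows "(X has_vector_derivative X') (at t) \<longleftrightarrow>
    (\<forall>i j. ((\<lambda>s. X s $ i $ j) has_real_derivative X' $ i $ j) (at t))"
  by (simp add: has_vector_derivative_def has_derivative_cart_iff has_field_derivative_def
      mult.commute[of _ "X' $ _ $ _"])

text \<open>Row indices are compared by an abstract strict linear order, since the lexicographic order on pairs
  is not the order that the type of pairs carries.\<close>

locale triangular_factors =
  fixes lt :: "'k::finite \<Rightarrow> 'k \<Rightarrow> bool"
  assumes irrefl: "\<not> lt a a" and trans: "lt a b \<Longrightarrow> lt b c \<Longrightarrow> lt a c"
    and linear: "lt a b \<or> a = b \<or> lt b a"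
begin

definition factor :: "real^'k^'k \<Rightarrow> real^'k^'k \<Rightarrow> bool" where
  "factor M R \<longleftrightarrow>
    (\<forall>a b. lt b a \<longrightarrow> R $ a $ b = 0) \<and> (\<forall>a. R $ a $ a > 0) \<and> M = transpose R ** R"

lemma wf_lt: "wf {(a, b). lt a b}" and wf_gt: "wf {(a, b). lt b a}"
proof -
  have "trans {(a, b). lt a b}" "trans {(a, b). lt b a}"
    by (auto intro!: transI intro: trans)
  then have "acyclic {(a, b). lt a b}" "acyclic {(a, b). lt b a}"
    by (simp_all add: acyclic_irrefl irrefl_def trancl_id irrefl)
  then show "wf {(a, b). lt a b}" "wf {(a, b). lt b a}"
    by (auto intro!: finite_acyclic_wf)
qed

text \<open>Back substitution: the kernel equations, read from the largest index downwards, give that all components vanish.\<close>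

lemma factor_invertible:
  assumes R: "factor M R"
  shows "invertible R"
proof -
  have "x $ a = 0" if "R *v x = 0" for x a
  proof (induction a rule: wf_induct_rule[OF wf_gt])
    case (1 a)
    have "(R *v x) $ a = (\<Sum>b\<in>UNIV. R $ a $ b * x $ b)"
      by (simp add: matrix_vector_mult_def)
    also have "\<dots> = (\<Sum>b\<in>UNIV. if b = a then R $ a $ a * x $ a else 0)"
    proof (intro sum.cong refl)
      fix b
      show "R $ a $ b * x $ b = (if b = a then R $ a $ a * x $ a else 0)"
        using linear[of a b] 1[of b] R by (auto simp: factor_def)
    qed
    finally show "x $ a = 0" using that R by (simp add: factor_def less_le)
  qed
  then have "\<forall>x. R *v x = 0 \<longrightarrow> x = 0" by (simp add: vec_eq_iff)
  then have "\<exists>X. X ** R = mat 1"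
    using matrix_left_invertible_ker[of R] by blast
  then show ?thesis
    by (rule invertible_left_inverse[THEN iffD2])
qed

text \<open>The Cholesky recursion: row \<open>a\<close> of \<open>R\<close> is determined by row \<open>a\<close> of \<open>M\<close> and the earlier rows of \<open>R\<close>.\<close>

lemma factor_entry:
  assumes R: "factor M R"
  shows "M $ a $ b = (\<Sum>k | lt k a. R $ k $ a * R $ k $ b) + R $ a $ a * R $ a $ b"
proof -
  have "M $ a $ b = (\<Sum>k\<in>UNIV. R $ k $ a * R $ k $ b)"
    using R by (simp add: factor_def matrix_matrix_mult_def transpose_def)
  also have "\<dots> = (\<Sum>k\<in>insert a {k. lt k a}. R $ k $ a * R $ k $ b)"
    using R linear by (intro sum.mono_neutral_right) (auto simp: factor_def)
  finally show ?thesis by (simp add: irrefl)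
qed

text \<open>Induction along the Cholesky recursion: first the diagonal entry of a row, as a square root of a positive
  differentiable function, then the other entries after division by it.\<close>

lemma factor_differentiable:
  fixes M R :: "real \<Rightarrow> real^'k^'k"
  assumes T: "open T" "t \<in> T" and chol: "\<And>s. s \<in> T \<Longrightarrow> factor (M s) (R s)"
    and M: "M differentiable (at t)"
  shows "R differentiable (at t)"
proof -
  have Mab: "(\<lambda>s. M s $ a $ b) differentiable (at t)" for a b
    using M by (simp add: differentiable_cart_iff)
  have "\<forall>b. (\<lambda>s. R s $ a $ b) differentiable (at t)" for a
  proof (induction a rule: wf_induct_rule[OF wf_lt])
    case (1 a)
    let ?rest = "\<lambda>b s. M s $ a $ b - (\<Sum>k | lt k a. R s $ k $ a * R s $ k $ b)"
    have rest: "?rest b differentiable (at t)" for b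
      using 1 by (intro differentiable_diff Mab differentiable_sum ballI differentiable_mult) auto
    have eq: "?rest b s = R s $ a $ a * R s $ a $ b" if "s \<in> T" for b s
      using factor_entry[OF chol[OF that], of a b] by simp
    have pos: "R s $ a $ a > 0" if "s \<in> T" for s
      using chol[OF that] by (simp add: factor_def)
    have diag: "(\<lambda>s. R s $ a $ a) differentiable (at t)"
    proof (rule differentiable_cong_open[OF T])
      show "sqrt (?rest a s) = R s $ a $ a" if "s \<in> T" for s
        using eq[OF that, of a] pos[OF that] by simp
      show "(\<lambda>s. sqrt (?rest a s)) differentiable (at t)"
        using eq[OF T(2), of a] pos[OF T(2)]
        by (intro real_sqrt_differentiable[where f = "?rest a"] rest) simp
    qed
    show ?case
    proof
      fix b
      show "(\<lambda>s. R s $ a $ b) differentiable (at t)"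
      proof (rule differentiable_cong_open[OF T])
        show "?rest b s / R s $ a $ a = R s $ a $ b" if "s \<in> T" for s
          using eq[OF that, of b] pos[OF that] by simp
        show "(\<lambda>s. ?rest b s / R s $ a $ a) differentiable (at t)"
          using pos[OF T(2)] by (intro differentiable_divide rest diag) simp
      qed
    qed
  qed
  then show ?thesis by (simp add: differentiable_cart_iff)
qed

text \<open>Conjugation of \<open>M' = R'\<^sup>T R + R\<^sup>T R'\<close> with \<open>R\<^sup>-\<^sup>1\<close>.\<close>

lemma factor_log_derivative:
  fixes M R :: "real \<Rightarrow> real^'k^'k"
  assumes T: "open T" "t \<in> T" and chol: "\<And>s. s \<in> T \<Longrightarrow> factor (M s) (R s)"
    and M: "(M has_vector_derivative M') (at t)"
  defines "S \<equiv> vector_derivative R (at t) ** matrix_inv (R t)"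
  shows "orth_mat (R t) M' = S + transpose S"
proof -
  define R' where "R' = vector_derivative R (at t)"
  have "R differentiable (at t)"
    by (rule factor_differentiable[OF T chol differentiableI_vector[OF M]])
  then have "(R has_vector_derivative R') (at t)"
    by (simp add: R'_def vector_derivative_works)
  then have R': "((\<lambda>s. R s $ i $ j) has_real_derivative R' $ i $ j) (at t)" for i j
    by (simp add: has_vector_derivative_matrix_iff)
  have M_eq: "(\<Sum>k\<in>UNIV. R s $ k $ i * R s $ k $ j) = M s $ i $ j" if "s \<in> T" for s i j
    using chol[OF that] by (simp add: factor_def matrix_matrix_mult_def transpose_def)
  have "((\<lambda>s. \<Sum>k\<in>UNIV. R s $ k $ i * R s $ k $ j) has_real_derivative
      (\<Sum>k\<in>UNIV. R' $ k $ i * R t $ k $ j + R' $ k $ j * R t $ k $ i)) (at t)" for i j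
    by (intro DERIV_sum DERIV_mult R')
  then have "((\<lambda>s. M s $ i $ j) has_real_derivative
      (\<Sum>k\<in>UNIV. R' $ k $ i * R t $ k $ j + R' $ k $ j * R t $ k $ i)) (at t)" for i j
    by (rule has_field_derivative_transform_within_open[OF _ T]) (rule M_eq)
  moreover have "((\<lambda>s. M s $ i $ j) has_real_derivative M' $ i $ j) (at t)" for i j
    using M by (simp add: has_vector_derivative_matrix_iff)
  ultimately have "M' $ i $ j = (\<Sum>k\<in>UNIV. R' $ k $ i * R t $ k $ j + R' $ k $ j * R t $ k $ i)" for i j
    by (rule DERIV_unique[rotated])
  then have M'_eq: "M' = transpose R' ** R t + transpose (R t) ** R'"
    by (simp add: vec_eq_iff matrix_matrix_mult_def transpose_def sum.distrib mult.commute)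
  have inv: "R t ** matrix_inv (R t) = mat 1"
    by (intro matrix_inv_cancel factor_invertible[OF chol] T)
  then have inv': "transpose (matrix_inv (R t)) ** transpose (R t) = mat 1"
    by (metis matrix_transpose_mul transpose_mat)
  have "orth_mat (R t) M' = transpose (matrix_inv (R t)) ** (transpose R' ** (R t ** matrix_inv (R t)))
      + (transpose (matrix_inv (R t)) ** transpose (R t)) ** (R' ** matrix_inv (R t))"
    unfolding orth_mat_def M'_eq
    by (simp only: matrix_add_ldistrib matrix_add_mult matrix_mul_assoc)
  then show ?thesis
    by (simp add: inv inv' S_def R'_def matrix_transpose_mul add.commute)
qed

end

definition lex_less :: "'n::linorder \<times> 'm::linorder \<Rightarrow> 'n \<times> 'm \<Rightarrow> bool" where
  "lex_less a b \<longleftrightarrow> fst a < fst b \<or> (fst a = fst b \<and> snd a < snd b)"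

interpretation lex: triangular_factors "lex_less :: 'n::{finite,linorder} \<times> 'm::{finite,linorder} \<Rightarrow> _"
  by unfold_locales (auto simp: lex_less_def prod_eq_iff)

lemma lex_factor_iff: "lex.factor M R \<longleftrightarrow> cholesky_factor M R"
  unfolding lex.factor_def cholesky_factor_def upper_triangular_def lex_less_def
  by (simp add: split_paired_all split_paired_All)

section \<open>Summation by parts and the mass matrix\<close>

lemma Phi_sandwich:
  "transpose (Phi \<phi> \<alpha> x) ** X ** Phi \<psi> \<beta> y = (\<phi> \<alpha> x * \<psi> \<beta> y) *\<^sub>R (X :: real^'m::finite^'m)"
  by (simp add: Phi_def transpose_scalar matrix_scalar_ac flip: scalar_matrix_assoc)

lemma quad_nth: "quad q f $ i = quad q (\<lambda>x. f x $ i)"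
  by (simp add: quad_def)

lemma pd_Phi:
  assumes "\<phi> \<beta> \<in> Polys p"
  shows "pd k (Phi \<phi> \<beta> :: _ \<Rightarrow> real^'m::finite^'m) x = pd k (\<phi> \<beta>) x *\<^sub>R mat 1"
proof -
  have "(\<phi> \<beta> has_derivative frechet_derivative (\<phi> \<beta>) (at x)) (at x)"
    using Polys_differentiable[OF assms] by (simp add: frechet_derivative_works)
  then have "((\<lambda>x. Phi \<phi> \<beta> x :: real^'m^'m) has_derivative
      (\<lambda>h. frechet_derivative (\<phi> \<beta>) (at x) h *\<^sub>R mat 1)) (at x)"
    unfolding Phi_def by (rule has_derivative_scaleR_left)
  from pd_eqI[OF this] show ?thesis by (simp add: pd_def)
qed

lemma pd_cart:
  fixes Y :: "real^'d::finite \<Rightarrow> real^'m::finite^'m"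
  assumes "\<And>i j. (\<lambda>x. Y x $ i $ j) differentiable (at x)"
  shows "pd k Y x $ i $ j = pd k (\<lambda>x. Y x $ i $ j) x"
proof -
  have "(\<lambda>x. Y x $ i) differentiable (at x)" for i
    using assms by (simp add: differentiable_cart_iff)
  moreover then have "Y differentiable (at x)" by (simp add: differentiable_cart_iff)
  ultimately show ?thesis by (simp add: pd_def frechet_derivative_cart)
qed

lemma adv_op_entry:
  fixes Y :: "'d::finite \<Rightarrow> real^'d \<Rightarrow> real^'m::finite^'m"
  assumes "\<phi> \<beta> \<in> Polys p"
  shows "adv_op \<phi> q Y $ (\<alpha>, i) $ (\<beta>, j)
    = (\<Sum>k\<in>UNIV. quad q (\<lambda>x. (\<phi> \<alpha> x * Y k x $ i $ j) * pd k (\<phi> \<beta>) x))"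
proof -
  have "transpose (Phi \<phi> \<alpha> x) ** Z ** pd k (Phi \<phi> \<beta>) x = (\<phi> \<alpha> x * pd k (\<phi> \<beta>) x) *\<^sub>R Z"
    for x k and Z :: "real^'m^'m"
    using assms by (simp add: pd_Phi) (simp add: Phi_def transpose_scalar matrix_scalar_ac flip: scalar_matrix_assoc)
  then show ?thesis
    by (simp add: adv_op_def of_blocks_def quad_nth mult_ac flip: quad_sum)
qed

lemma div_op_entry:
  assumes "\<And>k i j. (\<lambda>x. Y k x $ i $ j) \<in> Polys r"
  shows "div_op \<phi> q Y $ (\<alpha>, i) $ (\<beta>, j)
    = (\<Sum>k\<in>UNIV. quad q (\<lambda>x. (\<phi> \<alpha> x * \<phi> \<beta> x) * pd k (\<lambda>x. Y k x $ i $ j) x))"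
  using Polys_differentiable[OF assms]
  by (simp add: div_op_def of_blocks_def quad_nth Phi_sandwich pd_cart flip: quad_sum)

lemma bdry_op_entry:
  "bdry_op \<phi> Fs \<nu> qF Y $ (\<alpha>, i) $ (\<beta>, j)
    = (\<Sum>k\<in>UNIV. \<Sum>F\<in>Fs. \<nu> F $ k * quad (qF F) (\<lambda>x. (\<phi> \<alpha> x * \<phi> \<beta> x) * Y k x $ i $ j))"
proof -
  have "bdry_op \<phi> Fs \<nu> qF Y $ (\<alpha>, i) $ (\<beta>, j)
      = (\<Sum>F\<in>Fs. \<Sum>k\<in>UNIV. \<nu> F $ k * quad (qF F) (\<lambda>x. (\<phi> \<alpha> x * \<phi> \<beta> x) * Y k x $ i $ j))"
    by (simp add: bdry_op_def of_blocks_def bquad_def quad_nth Phi_sandwich quad_sum quad_cmult mult.assoc)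
  then show ?thesis by (simp only: sum.swap[of _ Fs])
qed

text \<open>The three integrands have degree at most \<open>3 p\<close> and add up to the \<open>k\<close>-th partial derivative of \<open>f g y\<close>, a
  polynomial of degree at most \<open>3 p + 1\<close>; hence all quadratures are exact.\<close>

lemma quadrature_divergence:
  fixes f g y :: "real^'d::finite \<Rightarrow> real"
  assumes el: "polyhedral_element \<Omega> Fs \<nu>" and q: "volume_quadrature \<Omega> (3 * p) q"
    and qF: "face_quadrature Fs \<nu> (3 * p + 1) qF"
    and f: "f \<in> Polys p" and g: "g \<in> Polys p" and y: "y \<in> Polys (p + 1)"
  shows "quad q (\<lambda>x. (f x * y x) * pd k g x) + quad q (\<lambda>x. (g x * y x) * pd k f x)
      + quad q (\<lambda>x. (f x * g x) * pd k y x)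
    = (\<Sum>F\<in>Fs. \<nu> F $ k * quad (qF F) (\<lambda>x. (f x * g x) * y x))"
proof -
  let ?s = "\<lambda>x. (f x * y x) * pd k g x + (g x * y x) * pd k f x + (f x * g x) * pd k y x"
  let ?D = "\<lambda>h x. frechet_derivative h (at x)"
  let ?f' = "\<lambda>x z. (f x * g x) * ?D y x z + (f x * ?D g x z + ?D f x z * g x) * y x"
  have s: "?s \<in> Polys (3 * p)"
  proof (intro Polys_add)
    show "(\<lambda>x. (f x * y x) * pd k g x) \<in> Polys (3 * p)"
      by (rule Polys_mono[OF _ Polys_pd_mult[OF g Polys_mult[OF f y]]]) simp
    show "(\<lambda>x. (g x * y x) * pd k f x) \<in> Polys (3 * p)"
      by (rule Polys_mono[OF _ Polys_pd_mult[OF f Polys_mult[OF g y]]]) simp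
    show "(\<lambda>x. (f x * g x) * pd k y x) \<in> Polys (3 * p)"
      by (rule Polys_mono[OF _ Polys_pd_mult[OF y Polys_mult[OF f g]]]) simp
  qed
  have fgy: "(\<lambda>x. (f x * g x) * y x) \<in> Polys (3 * p + 1)"
    by (rule Polys_mono[OF _ Polys_mult[OF Polys_mult[OF f g] y]]) simp
  have deriv: "(h has_derivative ?D h x) (at x)" if "h \<in> Polys r" for h :: "real^'d \<Rightarrow> real" and r x
    using Polys_differentiable[OF that] by (simp add: frechet_derivative_works)
  have f's: "?f' x (axis k 1) = ?s x" for x by (simp add: pd_def algebra_simps)
  have "quad q (\<lambda>x. (f x * y x) * pd k g x) + quad q (\<lambda>x. (g x * y x) * pd k f x)
      + quad q (\<lambda>x. (f x * g x) * pd k y x) = quad q ?s"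
    by (simp only: quad_add)
  also have "\<dots> = (LINT x:\<Omega>|lborel. ?s x)"
    using q s by (simp add: volume_quadrature_def)
  also have "\<dots> = (LINT x:\<Omega>|lborel. ?f' x (axis k 1))"
    by (simp only: f's)
  also have "\<dots> = (\<Sum>F\<in>Fs. (\<nu> F \<bullet> axis k 1) * face_integral F (\<nu> F) (\<lambda>x. (f x * g x) * y x))"
  proof (rule polyhedral_divergence[OF el])
    show "axis k (1::real) \<bullet> axis k 1 = 1" by (simp add: inner_axis_axis)
    show "((\<lambda>x. (f x * g x) * y x) has_derivative ?f' x) (at x)" for x
      by (intro has_derivative_mult deriv[OF f] deriv[OF g] deriv[OF y])
    show "continuous_on UNIV (\<lambda>x. ?f' x (axis k 1))"
      unfolding f's by (rule Polys_continuous[OF s])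
  qed
  also have "\<dots> = (\<Sum>F\<in>Fs. \<nu> F $ k * quad (qF F) (\<lambda>x. (f x * g x) * y x))"
    using qF fgy by (intro sum.cong) (auto simp: face_quadrature_def inner_axis)
  finally show ?thesis .
qed

text \<open>Symmetry of \<open>Y\<close> is what makes the transposed advection block contain the derivative of the test
  function with the same coefficient.\<close>

theorem summation_by_parts:
  assumes el: "polyhedral_element \<Omega> Fs \<nu>" and q: "volume_quadrature \<Omega> (3 * p) q"
    and qF: "face_quadrature Fs \<nu> (3 * p + 1) qF"
    and \<phi>: "\<And>\<alpha>. \<phi> \<alpha> \<in> Polys p" and Y: "\<And>k i j. (\<lambda>x. Y k x $ i $ j) \<in> Polys (p + 1)"
    and sym: "\<And>k x. sym_mat (Y k x)"
  shows "adv_op \<phi> q Y + transpose (adv_op \<phi> q Y) + div_op \<phi> q Y = bdry_op \<phi> Fs \<nu> qF Y"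
proof -
  have Ysym: "Y k x $ j $ i = Y k x $ i $ j" for k x i j
    using sym[of k x] by (simp add: sym_mat_def vec_eq_iff transpose_def)
  have "(adv_op \<phi> q Y + transpose (adv_op \<phi> q Y) + div_op \<phi> q Y) $ (\<alpha>, i) $ (\<beta>, j)
      = bdry_op \<phi> Fs \<nu> qF Y $ (\<alpha>, i) $ (\<beta>, j)" for \<alpha> i \<beta> j
    using quadrature_divergence[OF el q qF \<phi> \<phi> Y]
    by (simp add: transpose_def adv_op_entry[OF \<phi>] div_op_entry[OF Y] bdry_op_entry Ysym[of _ _ i j]
        flip: sum.distrib)
  then show ?thesis by (simp add: vec_eq_iff)
qed

lemma div_op_sym:
  assumes Y: "\<And>k i j. (\<lambda>x. Y k x $ i $ j) \<in> Polys r" and sym: "\<And>k x. sym_mat (Y k x)"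
  shows "sym_mat (div_op \<phi> q Y)"
proof -
  have "Y k x $ j $ i = Y k x $ i $ j" for k x i j
    using sym[of k x] by (simp add: sym_mat_def vec_eq_iff transpose_def)
  then have "div_op \<phi> q Y $ (\<alpha>, i) $ (\<beta>, j) = div_op \<phi> q Y $ (\<beta>, j) $ (\<alpha>, i)" for \<alpha> i \<beta> j
    by (simp only: div_op_entry[OF Y] mult.commute[of "\<phi> \<alpha> _"])
  then show ?thesis by (simp add: sym_mat_def vec_eq_iff transpose_def)
qed

lemma bdry_op_sym:
  assumes sym: "\<And>k x. sym_mat (Y k x)"
  shows "sym_mat (bdry_op \<phi> Fs \<nu> qF Y)"
proof -
  have "Y k x $ j $ i = Y k x $ i $ j" for k x i j
    using sym[of k x] by (simp add: sym_mat_def vec_eq_iff transpose_def)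
  then have "bdry_op \<phi> Fs \<nu> qF Y $ (\<alpha>, i) $ (\<beta>, j) = bdry_op \<phi> Fs \<nu> qF Y $ (\<beta>, j) $ (\<alpha>, i)" for \<alpha> i \<beta> j
    by (simp only: bdry_op_entry mult.commute[of "\<phi> \<alpha> _"])
  then show ?thesis by (simp add: sym_mat_def vec_eq_iff transpose_def)
qed

lemma Yproj_Polys:
  assumes "volume_quadrature \<Omega> n q"
  shows "(\<lambda>x. Yproj e q r X u k x $ i $ j) \<in> Polys r"
  using disc_proj_in_Polys[of q] assms by (simp add: Yproj_def volume_quadrature_def)

text \<open>The projection only sees the values at the nodes, so symmetry at the nodes already makes the projected entries equal
  as functions.\<close>

lemma Yproj_sym:
  assumes "\<And>z. z \<in> fst q \<Longrightarrow> sym_mat (Hmat e (u z) ** X k (u z))"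
  shows "sym_mat (Yproj e q r X u k x)"
proof -
  have "(Hmat e (u z) ** X k (u z)) $ j $ i = (Hmat e (u z) ** X k (u z)) $ i $ j" if "z \<in> fst q" for z i j
    using assms[OF that] by (simp add: sym_mat_def vec_eq_iff transpose_def del: matrix_matrix_mult_def)
  then have "disc_proj q r (\<lambda>z. (Hmat e (u z) ** X k (u z)) $ j $ i)
      = disc_proj q r (\<lambda>z. (Hmat e (u z) ** X k (u z)) $ i $ j)" for i j
    by (rule disc_proj_cong)
  then show ?thesis by (simp add: Yproj_def sym_mat_def vec_eq_iff transpose_def)
qed

lemma mass_op_entry:
  "mass_op e \<phi> q u $ (\<alpha>, i) $ (\<beta>, j) = quad q (\<lambda>x. (\<phi> \<alpha> x * \<phi> \<beta> x) * Hmat e (u x) $ i $ j)"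
  by (simp add: mass_op_def of_blocks_def quad_nth Phi_sandwich)

lemma mass_dot_op_entry:
  "mass_dot_op e \<phi> q u ut $ (\<alpha>, i) $ (\<beta>, j)
    = quad q (\<lambda>x. (\<phi> \<alpha> x * \<phi> \<beta> x) * frechet_derivative (Hmat e) (at (u x)) (ut x) $ i $ j)"
  by (simp add: mass_dot_op_def of_blocks_def quad_nth Phi_sandwich)

lemma state_eq: "state \<phi> U x = (\<Sum>\<alpha>\<in>UNIV. \<phi> \<alpha> x *\<^sub>R blockv U \<alpha>)"
  by (simp add: state_def Phi_def flip: scaleR_matrix_vector_assoc)

lemma linear_blockv: "linear (\<lambda>U. blockv U \<alpha>)"
  by (rule linearI) (simp_all add: blockv_def vec_eq_iff)

lemma state_differentiable:
  assumes "U differentiable (at t)"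
  shows "(\<lambda>s. state \<phi> (U s) x) differentiable (at t)"
proof -
  have "linear (\<lambda>V. state \<phi> V x)"
    unfolding state_eq
    by (intro linear_compose_sum ballI linear_compose_scale_right linear_blockv)
  then have bl: "bounded_linear (\<lambda>V. state \<phi> V x)" by (simp add: linear_conv_bounded_linear)
  obtain D where D: "(U has_derivative D) (at t)"
    using assms by (auto simp: differentiable_def)
  show ?thesis
    unfolding differentiable_def by (rule exI) (rule bounded_linear.has_derivative[OF bl D])
qed

context energy_structure_on
begin

lemma mass_op_has_derivative:
  assumes q: "\<And>x. x \<in> fst q \<Longrightarrow> u t x \<in> \<U>"
    and u: "\<And>x. (\<lambda>s. u s x) differentiable (at t)"
  shows "((\<lambda>s. mass_op e \<phi> q (u s)) has_vector_derivative
    mass_dot_op e \<phi> q (u t) (\<lambda>x. vector_derivative (\<lambda>s. u s x) (at t))) (at t)"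
proof -
  let ?ut = "\<lambda>x. vector_derivative (\<lambda>s. u s x) (at t)"
  have H: "((\<lambda>s. Hmat e (u s x)) has_vector_derivative
      frechet_derivative (Hmat e) (at (u t x)) (?ut x)) (at t)" if "x \<in> fst q" for x
  proof -
    let ?D = "frechet_derivative (Hmat e) (at (u t x))"
    have D: "(Hmat e has_derivative ?D) (at (u t x))"
      using Hmat_differentiable[OF q[OF that]] by (simp add: frechet_derivative_works)
    have "((\<lambda>s. u s x) has_derivative (\<lambda>h. h *\<^sub>R ?ut x)) (at t)"
      using u[of x] by (simp add: vector_derivative_works has_vector_derivative_def)
    from has_derivative_compose[OF this D] show ?thesis
      by (simp add: has_vector_derivative_def linear_cmul[OF has_derivative_linear[OF D]])
  qed
  have "((\<lambda>s. quad q (\<lambda>x. (\<phi> \<alpha> x * \<phi> \<beta> x) * Hmat e (u s x) $ i $ j)) has_real_derivative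
      quad q (\<lambda>x. (\<phi> \<alpha> x * \<phi> \<beta> x) * frechet_derivative (Hmat e) (at (u t x)) (?ut x) $ i $ j)) (at t)"
    for \<alpha> \<beta> i j
    unfolding quad_def real_scaleR_def
    using H by (intro DERIV_sum DERIV_cmult) (auto simp: has_vector_derivative_matrix_iff)
  then have "((\<lambda>s. mass_op e \<phi> q (u s) $ (\<alpha>, i) $ (\<beta>, j)) has_real_derivative
      mass_dot_op e \<phi> q (u t) ?ut $ (\<alpha>, i) $ (\<beta>, j)) (at t)" for \<alpha> i \<beta> j
    by (simp only: mass_op_entry mass_dot_op_entry)
  then show ?thesis by (simp add: has_vector_derivative_matrix_iff)
qed

lemma mass_dot_op_sym:
  assumes "\<And>x. x \<in> fst q \<Longrightarrow> u x \<in> \<U>"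
  shows "sym_mat (mass_dot_op e \<phi> q u ut)"
proof -
  let ?D = "\<lambda>x. frechet_derivative (Hmat e) (at (u x)) (ut x)"
  have "?D x $ j $ i = ?D x $ i $ j" if "x \<in> fst q" for x i j
    using sym_Hmat_derivative[OF assms[OF that], of "ut x"]
    by (simp add: sym_mat_def vec_eq_iff transpose_def)
  then have "quad q (\<lambda>x. (\<phi> \<alpha> x * \<phi> \<beta> x) * ?D x $ i $ j) = quad q (\<lambda>x. (\<phi> \<beta> x * \<phi> \<alpha> x) * ?D x $ j $ i)"
    for \<alpha> \<beta> i j
    by (intro quad_cong) simp
  then have "mass_dot_op e \<phi> q u ut $ (\<alpha>, i) $ (\<beta>, j) = mass_dot_op e \<phi> q u ut $ (\<beta>, j) $ (\<alpha>, i)"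
    for \<alpha> i \<beta> j by (simp only: mass_dot_op_entry)
  then show ?thesis by (simp add: sym_mat_def vec_eq_iff transpose_def)
qed

end

section \<open>Skew form of the closed system\<close>

lemma outer_mult_vec: "outer u v *v w = (v \<bullet> w) *\<^sub>R u"
  by (simp add: vec_eq_iff outer_def matrix_vector_mult_def inner_vec_def sum_distrib_left mult_ac)

lemma transpose_outer: "transpose (outer u v) = outer v u"
  by (simp add: vec_eq_iff outer_def transpose_def mult.commute)

lemma transpose_add: "transpose (X + Y) = transpose X + transpose Y"
  by (simp add: vec_eq_iff transpose_def)

lemma transpose_diff: "transpose (X - Y) = transpose X - transpose (Y :: real^'n^'m)"
  by (simp add: vec_eq_iff transpose_def)

lemma transpose_skw: "transpose (skw X) = - skw X"
  by (simp add: skw_def transpose_scalar transpose_diff flip: scaleR_minus_right)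

lemma orth_mat_add: "orth_mat R (X + Y) = orth_mat R X + orth_mat R Y"
  by (simp add: orth_mat_def matrix_add_ldistrib matrix_add_mult)

lemma transpose_orth_mat: "transpose (orth_mat R X) = orth_mat R (transpose X)"
  by (simp add: orth_mat_def matrix_transpose_mul matrix_mul_assoc)

lemma sym_orth_mat: "sym_mat X \<Longrightarrow> sym_mat (orth_mat R X)"
  by (simp add: sym_mat_def transpose_orth_mat)

lemma corrected_action_orthogonal:
  assumes "u \<noteq> 0" and L: "L = ((u \<bullet> (C *v u)) / norm u ^ 4) *\<^sub>R outer u u"
  shows "u \<bullet> ((C - L) *v u) = 0"
proof -
  have "u \<bullet> (L *v u) = (u \<bullet> (C *v u)) / norm u ^ 4 * ((u \<bullet> u) * (u \<bullet> u))"
    by (simp add: L outer_mult_vec flip: scaleR_matrix_vector_assoc)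
  also have "(u \<bullet> u) * (u \<bullet> u) = norm u ^ 4"
    by (simp add: dot_square_norm power4_eq_xxxx power2_eq_square)
  finally show ?thesis
    using assms(1) by (simp add: matrix_vector_mult_diff_rdistrib inner_diff_right)
qed

lemma rank_two_skew_action:
  assumes "u \<noteq> 0" and orth: "u \<bullet> (X *v u) = 0"
    and K: "K = (1 / (norm u)\<^sup>2) *\<^sub>R (X ** outer u u - outer u u ** X)"
  shows "K *v u = X *v u"
proof -
  have "(X ** outer u u - outer u u ** X) *v u = (u \<bullet> u) *\<^sub>R (X *v u)"
    by (simp add: matrix_vector_mult_diff_rdistrib outer_mult_vec orth matrix_vector_mult_scaleR
        flip: matrix_vector_mul_assoc)
  then have "K *v u = (1 / (norm u)\<^sup>2 * (u \<bullet> u)) *\<^sub>R (X *v u)"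
    by (simp add: K flip: scaleR_matrix_vector_assoc)
  then show ?thesis using assms(1) by (simp add: dot_square_norm)
qed

lemma rank_two_skew_transpose:
  assumes X: "sym_mat X" and K: "K = c *\<^sub>R (X ** outer u u - outer u u ** X)"
  shows "transpose K = - K"
  using X by (simp add: K sym_mat_def transpose_scalar transpose_diff matrix_transpose_mul transpose_outer
      flip: scaleR_minus_right)

text \<open>Inserting \<open>S = skw S + 1/2 D\<close> and \<open>N = skw N + 1/2 (B - V)\<close> gives
  \<open>S - N + B = skw S - skw N + 1/2 (D + V + B)\<close>, where \<open>1/2 (D + V + B) = C + 1/2 B - 1/2 B\<^sub>\<Delta>\<close>; and
  \<open>(C - L) u = K u\<close>.\<close>

lemma skew_form_of_closed_system:
  fixes N S B B\<Delta> V D C L K :: "real^'k^'k" and u Q :: "real^'k"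
  assumes u: "u \<noteq> 0" and parts: "N + transpose N + V = B" and mass: "S + transpose S = D"
    and C: "C = (1/2) *\<^sub>R (D + V + B\<Delta>)"
    and L: "L = ((u \<bullet> (C *v u)) / norm u ^ 4) *\<^sub>R outer u u"
    and K: "K = (1 / (norm u)\<^sup>2) *\<^sub>R ((C - L) ** outer u u - outer u u ** (C - L))"
  shows "(S - N + B) *v u - Q - L *v u
    = - ((skw N - skw S - K) *v u) + (1/2) *\<^sub>R ((B + B\<Delta>) *v u) - (Q + B\<Delta> *v u)"
proof -
  have "K *v u = (C - L) *v u"
    by (rule rank_two_skew_action[OF u corrected_action_orthogonal[OF u L] K])
  then have Ku: "K *v u = (1/2) *\<^sub>R (D *v u + V *v u + B\<Delta> *v u) - L *v u"
    by (simp add: C matrix_vector_mult_diff_rdistrib matrix_vector_mult_add_rdistrib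
        flip: scaleR_matrix_vector_assoc)
  have "transpose N = B - V - N" "transpose S = D - S"
    using parts mass by (auto simp: algebra_simps)
  then have "transpose N *v u = B *v u - V *v u - N *v u" "transpose S *v u = D *v u - S *v u"
    by (simp_all add: matrix_vector_mult_diff_rdistrib)
  then have "skw N *v u = (1/2) *\<^sub>R (N *v u - (B *v u - V *v u - N *v u))"
    "skw S *v u = (1/2) *\<^sub>R (S *v u - (D *v u - S *v u))"
    by (simp_all only: skw_def matrix_vector_mult_diff_rdistrib flip: scaleR_matrix_vector_assoc)
  then show ?thesis
    by (simp add: matrix_vector_mult_diff_rdistrib matrix_vector_mult_add_rdistrib Ku)
       (simp add: vec_eq_iff field_simps)
qed

lemma blockv_mult:
  "blockv (X *v U) \<alpha> = (\<Sum>\<beta>\<in>UNIV. block X \<alpha> \<beta> *v blockv U \<beta>)"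
  by (simp add: vec_eq_iff blockv_def block_def matrix_vector_mult_def sum.cartesian_product
      UNIV_Times_UNIV[symmetric] case_prod_unfold del: UNIV_Times_UNIV)

lemma blockv_arith:
  "blockv (- U) \<alpha> = - blockv U \<alpha>" "blockv (U + W) \<alpha> = blockv U \<alpha> + blockv W \<alpha>"
  "blockv (U - W) \<alpha> = blockv U \<alpha> - blockv W \<alpha>" "blockv (c *\<^sub>R U) \<alpha> = c *\<^sub>R blockv U \<alpha>"
  by (simp_all add: blockv_def vec_eq_iff)

lemma block_skew_exchange:
  assumes "transpose X = - X"
  shows "v \<bullet> (block X \<alpha> \<beta> *v w) = - (w \<bullet> (block X \<beta> \<alpha> *v v))"
proof -
  have X: "X $ b $ a = - X $ a $ b" for a b
  proof -
    have "transpose X $ a $ b = (- X) $ a $ b" by (simp only: assms)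
    then show ?thesis by (simp add: transpose_def)
  qed
  have "v \<bullet> (block X \<alpha> \<beta> *v w) = (\<Sum>i\<in>UNIV. \<Sum>j\<in>UNIV. v $ i * X $ (\<alpha>, i) $ (\<beta>, j) * w $ j)"
    by (simp add: inner_vec_def matrix_vector_mult_def block_def sum_distrib_left mult.assoc)
  also have "\<dots> = (\<Sum>j\<in>UNIV. \<Sum>i\<in>UNIV. v $ i * X $ (\<alpha>, i) $ (\<beta>, j) * w $ j)"
    by (rule sum.swap)
  also have "\<dots> = (\<Sum>j\<in>UNIV. \<Sum>i\<in>UNIV. - (w $ j * X $ (\<beta>, j) $ (\<alpha>, i) * v $ i))"
    by (simp add: X[of "(\<beta>, _)" "(\<alpha>, _)"] mult_ac)
  also have "\<dots> = - (w \<bullet> (block X \<beta> \<alpha> *v v))"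
    by (simp add: inner_vec_def matrix_vector_mult_def block_def sum_distrib_left sum_negf mult.assoc)
  finally show ?thesis .
qed

lemma sum_antisymmetric:
  fixes P :: "'n::finite \<Rightarrow> 'n \<Rightarrow> real"
  assumes "\<And>\<alpha> \<beta>. P \<alpha> \<beta> = - P \<beta> \<alpha>"
  shows "(\<Sum>\<alpha>\<in>UNIV. \<Sum>\<beta>\<in>UNIV. P \<alpha> \<beta>) = 0"
proof -
  have "(\<Sum>\<alpha>\<in>UNIV. \<Sum>\<beta>\<in>UNIV. P \<alpha> \<beta>) = (\<Sum>\<beta>\<in>UNIV. \<Sum>\<alpha>\<in>UNIV. P \<alpha> \<beta>)"
    by (rule sum.swap)
  also have "\<dots> = (\<Sum>\<beta>\<in>UNIV. \<Sum>\<alpha>\<in>UNIV. - P \<beta> \<alpha>)"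
    by (intro sum.cong refl assms)
  finally show ?thesis by (simp add: sum_negf)
qed

lemma half_norm_square_derivative:
  assumes "(b has_vector_derivative b') (at t)"
  shows "((\<lambda>s. 1/2 * (norm (b s))\<^sup>2) has_real_derivative b t \<bullet> b') (at t)"
proof -
  have "((\<lambda>s. 1/2 * (b s \<bullet> b s)) has_derivative (\<lambda>h. 1/2 * (b t \<bullet> (h *\<^sub>R b') + (h *\<^sub>R b') \<bullet> b t))) (at t)"
    using assms unfolding has_vector_derivative_def
    by (intro has_derivative_mult_right has_derivative_inner)
  moreover have "(\<lambda>h. 1/2 * (b t \<bullet> (h *\<^sub>R b') + (h *\<^sub>R b') \<bullet> b t)) = (*) (b t \<bullet> b')"
    by (simp add: fun_eq_iff inner_commute)
  ultimately show ?thesis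
    by (simp only: has_field_derivative_def power2_norm_eq_inner)
qed

theorem theorem6p6:
  fixes \<U> :: "(real^'m::{finite,linorder}) set"
    and F :: "'d::finite \<Rightarrow> real^'m::{finite,linorder} \<Rightarrow> real^'m::{finite,linorder}"
    and e :: "real^'m::{finite,linorder} \<Rightarrow> real"
    and g :: "'d \<Rightarrow> real^'m::{finite,linorder} \<Rightarrow> real"
    and G \<Delta>A :: "'d \<Rightarrow> real^'m::{finite,linorder} \<Rightarrow> real^'m::{finite,linorder}^'m::{finite,linorder}"
    and cH CH :: real
    and \<Omega> :: "(real^'d) set"
    and Fs :: "(real^'d) set set"
    and \<nu> :: "(real^'d) set \<Rightarrow> real^'d"
    and p n :: nat
    and \<phi> :: "'n::{finite,linorder} \<Rightarrow> real^'d \<Rightarrow> real"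
    and q3p qhi :: "'d quadrature"
    and qF :: "(real^'d) set \<Rightarrow> 'd quadrature"
    and Qflux :: "(real^'d \<Rightarrow> real^'m::{finite,linorder}) \<Rightarrow> (real^'d \<Rightarrow> real^'m::{finite,linorder}) \<Rightarrow> real^('n::{finite,linorder} \<times> 'm::{finite,linorder})"
    and uext :: "real \<Rightarrow> real^'d \<Rightarrow> real^'m::{finite,linorder}"
    and T :: "real set"
    and U Uo Qo QGo :: "real \<Rightarrow> real^('n::{finite,linorder} \<times> 'm::{finite,linorder})"
    and up :: "real \<Rightarrow> real^'d \<Rightarrow> real^'m::{finite,linorder}"
    and YA Y\<Delta>A :: "real \<Rightarrow> 'd \<Rightarrow> real^'d \<Rightarrow> real^'m::{finite,linorder}^'m::{finite,linorder}"
    and M Md N V B B\<Delta> R S Mdo No Vo Bo B\<Delta>o BGo C L CEC KEC ::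
      "real \<Rightarrow> real^('n::{finite,linorder} \<times> 'm::{finite,linorder})^('n::{finite,linorder} \<times> 'm::{finite,linorder})"
    and \<rho> :: "real \<Rightarrow> real"
    and E :: "'n::{finite,linorder} \<Rightarrow> real \<Rightarrow> real"
    and P :: "real \<Rightarrow> 'n::{finite,linorder} \<Rightarrow> 'n::{finite,linorder} \<Rightarrow> real"
  assumes energy: "energy_structure \<U> F e g G \<Delta>A cH CH"
    and element: "polyhedral_element \<Omega> Fs \<nu>"
    and basis: "L2_orthonormal_basis \<Omega> p \<phi>"
    and quad_3p: "volume_quadrature \<Omega> (3 * p) q3p"
    and quad_face: "face_quadrature Fs \<nu> (3 * p + 1) qF"
    and quad_hi: "n \<ge> 3 * p + 1" "volume_quadrature \<Omega> n qhi"
    \<comment> \<open>trajectory\<close>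
    and time: "open T"
    and U_diff: "\<forall>t\<in>T. U differentiable (at t)"
    and up: "up = (\<lambda>t. state \<phi> (U t))"
    and admissible: "\<forall>t\<in>T. \<forall>x\<in>\<Omega>. up t x \<in> \<U>"
    \<comment> \<open>CPG operators along the trajectory\<close>
    and YA: "YA = (\<lambda>t. Yproj e qhi (p + 1) (Amat F) (up t))"
    and Y\<Delta>A: "Y\<Delta>A = (\<lambda>t. Yproj e qhi (p + 1) \<Delta>A (up t))"
    and M: "M = (\<lambda>t. mass_op e \<phi> q3p (up t))"
    and Md: "Md = (\<lambda>t. mass_dot_op e \<phi> q3p (up t) (\<lambda>x. vector_derivative (\<lambda>s. up s x) (at t)))"
    and N: "N = (\<lambda>t. adv_op \<phi> q3p (YA t))"
    and V: "V = (\<lambda>t. div_op \<phi> q3p (YA t))"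
    and B: "B = (\<lambda>t. bdry_op \<phi> Fs \<nu> qF (YA t))"
    and B\<Delta>: "B\<Delta> = (\<lambda>t. bdry_op \<phi> Fs \<nu> qF (Y\<Delta>A t))"
    \<comment> \<open>orthogonalization\<close>
    and R: "\<forall>t\<in>T. cholesky_factor (M t) (R t)"
    and S: "S = (\<lambda>t. vector_derivative R (at t) ** matrix_inv (R t))"
    and Uo: "Uo = (\<lambda>t. R t *v U t)"
    and Mdo: "Mdo = (\<lambda>t. orth_mat (R t) (Md t))"
    and No: "No = (\<lambda>t. orth_mat (R t) (N t))"
    and Vo: "Vo = (\<lambda>t. orth_mat (R t) (V t))"
    and Bo: "Bo = (\<lambda>t. orth_mat (R t) (B t))"
    and B\<Delta>o: "B\<Delta>o = (\<lambda>t. orth_mat (R t) (B\<Delta> t))"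
    and Qo: "Qo = (\<lambda>t. orth_vec (R t)
      (Qflux (restrict (up t) (frontier \<Omega>)) (restrict (uext t) (frontier \<Omega>))))"
    \<comment> \<open>the closure and the closed system\<close>
    and C: "C = (\<lambda>t. (1/2) *\<^sub>R (Mdo t + Vo t + B\<Delta>o t))"
    and \<rho>: "\<rho> = (\<lambda>t. Uo t \<bullet> (C t *v Uo t))"
    and L: "L = (\<lambda>t. (\<rho> t / norm (Uo t) ^ 4) *\<^sub>R outer (Uo t) (Uo t))"
    and CEC: "CEC = (\<lambda>t. C t - L t)"
    and Uo_nonzero: "\<forall>t\<in>T. Uo t \<noteq> 0"
    and closed_system: "\<forall>t\<in>T.
      (Uo has_vector_derivative ((S t - No t + Bo t) *v Uo t - Qo t - L t *v Uo t)) (at t)"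
    \<comment> \<open>quantities in the conclusion\<close>
    and KEC: "KEC = (\<lambda>t. (1 / (norm (Uo t))\<^sup>2) *\<^sub>R
      (CEC t ** outer (Uo t) (Uo t) - outer (Uo t) (Uo t) ** CEC t))"
    and BGo: "BGo = (\<lambda>t. Bo t + B\<Delta>o t)"
    and QGo: "QGo = (\<lambda>t. Qo t + B\<Delta>o t *v Uo t)"
    and E: "E = (\<lambda>\<alpha> t. 1/2 * (norm (blockv (Uo t) \<alpha>))\<^sup>2)"
    and P: "P = (\<lambda>t \<alpha> \<beta>. - (blockv (Uo t) \<alpha> \<bullet>
      (block (skw (No t) - skw (S t) - KEC t) \<alpha> \<beta> *v blockv (Uo t) \<beta>)))"
  shows "\<forall>t\<in>T.
    (\<forall>\<alpha>. ((\<lambda>s. blockv (Uo s) \<alpha>) has_vector_derivative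
        (- (\<Sum>\<beta>\<in>UNIV. block (skw (No t) - skw (S t) - KEC t) \<alpha> \<beta> *v blockv (Uo t) \<beta>)
         + (1/2) *\<^sub>R (\<Sum>\<beta>\<in>UNIV. block (BGo t) \<alpha> \<beta> *v blockv (Uo t) \<beta>)
         - blockv (QGo t) \<alpha>)) (at t)) \<and>
    (\<forall>\<alpha>. (E \<alpha> has_real_derivative
        ((\<Sum>\<beta>\<in>UNIV. P t \<alpha> \<beta>)
         + 1/2 * (\<Sum>\<beta>\<in>UNIV. blockv (Uo t) \<alpha> \<bullet> (block (BGo t) \<alpha> \<beta> *v blockv (Uo t) \<beta>))
         - blockv (Uo t) \<alpha> \<bullet> blockv (QGo t) \<alpha>)) (at t)) \<and>
    (\<forall>\<alpha> \<beta>. P t \<alpha> \<beta> = - P t \<beta> \<alpha>) \<and>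
    (\<Sum>\<alpha>\<in>UNIV. \<Sum>\<beta>\<in>UNIV. P t \<alpha> \<beta>) = 0 \<and>
    ((\<lambda>s. \<Sum>\<alpha>\<in>UNIV. E \<alpha> s) has_real_derivative
        (1/2 * (\<Sum>\<alpha>\<in>UNIV. \<Sum>\<beta>\<in>UNIV.
            blockv (Uo t) \<alpha> \<bullet> (block (BGo t) \<alpha> \<beta> *v blockv (Uo t) \<beta>))
         - (\<Sum>\<alpha>\<in>UNIV. blockv (Uo t) \<alpha> \<bullet> blockv (QGo t) \<alpha>))) (at t)"
proof
  fix t assume t: "t \<in> T"
  interpret energy_structure_on \<U> F e g G \<Delta>A cH CH
    by unfold_locales (rule energy)
  define K where "K = skw (No t) - skw (S t) - KEC t"
  have nodes_3p: "up s x \<in> \<U>" if "s \<in> T" "x \<in> fst q3p" for s x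
    using that admissible quad_3p by (auto simp: volume_quadrature_def)
  have nodes_hi: "up s x \<in> \<U>" if "s \<in> T" "x \<in> fst qhi" for s x
    using that admissible quad_hi by (auto simp: volume_quadrature_def)
  have \<phi>_poly: "\<phi> \<alpha> \<in> Polys p" for \<alpha>
    using basis by (simp add: L2_orthonormal_basis_def)
  have YA_poly: "(\<lambda>x. YA t k x $ i $ j) \<in> Polys (p + 1)" for k i j
    unfolding YA by (rule Yproj_Polys[OF quad_hi(2)])
  have YA_sym: "sym_mat (YA t k x)" for k x
    unfolding YA using nodes_hi[OF t] by (intro Yproj_sym sym_Hmat_Amat)
  have Y\<Delta>A_sym: "sym_mat (Y\<Delta>A t k x)" for k x
    unfolding Y\<Delta>A using nodes_hi[OF t] by (intro Yproj_sym sym_Hmat_DeltaA)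
  have "N t + transpose (N t) + V t = B t"
    unfolding N V B by (rule summation_by_parts[OF element quad_3p quad_face \<phi>_poly YA_poly YA_sym])
  then have parts: "No t + transpose (No t) + Vo t = Bo t"
    unfolding No Vo Bo by (simp add: transpose_orth_mat flip: orth_mat_add)
  have "(M has_vector_derivative Md t) (at t)"
    unfolding M Md
  proof (rule mass_op_has_derivative)
    show "up t x \<in> \<U>" if "x \<in> fst q3p" for x by (rule nodes_3p[OF t that])
    show "(\<lambda>s. up s x) differentiable (at t)" for x
      unfolding up using U_diff t by (intro state_differentiable) blast
  qed
  then have mass: "S t + transpose (S t) = Mdo t"
    unfolding S Mdo using R
    by (intro lex.factor_log_derivative[OF time t, symmetric]) (simp_all add: lex_factor_iff)
  have "sym_mat (Md t)" "sym_mat (V t)" "sym_mat (B\<Delta> t)"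
    unfolding Md V B\<Delta> using nodes_3p[OF t]
    by (auto intro!: mass_dot_op_sym div_op_sym[OF YA_poly YA_sym] bdry_op_sym[OF Y\<Delta>A_sym])
  then have "sym_mat (Mdo t)" "sym_mat (Vo t)" "sym_mat (B\<Delta>o t)"
    unfolding Mdo Vo B\<Delta>o by (auto intro: sym_orth_mat)
  then have CEC_sym: "sym_mat (CEC t)"
    unfolding CEC C L
    by (simp add: sym_mat_def transpose_diff transpose_add transpose_scalar transpose_outer)
  have KEC_t: "KEC t = (1 / (norm (Uo t))\<^sup>2) *\<^sub>R
      (CEC t ** outer (Uo t) (Uo t) - outer (Uo t) (Uo t) ** CEC t)"
    by (simp add: KEC)
  have K_skew: "transpose K = - K"
    using rank_two_skew_transpose[OF CEC_sym KEC_t]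
    by (simp add: K_def transpose_diff transpose_skw)
  have rhs: "(S t - No t + Bo t) *v Uo t - Qo t - L t *v Uo t
      = - (K *v Uo t) + (1/2) *\<^sub>R (BGo t *v Uo t) - QGo t"
    unfolding K_def BGo QGo
  proof (rule skew_form_of_closed_system[OF _ parts mass])
    show "Uo t \<noteq> 0" using Uo_nonzero t by blast
    show "C t = (1/2) *\<^sub>R (Mdo t + Vo t + B\<Delta>o t)" by (simp add: C)
    show "L t = ((Uo t \<bullet> (C t *v Uo t)) / norm (Uo t) ^ 4) *\<^sub>R outer (Uo t) (Uo t)"
      by (simp add: L \<rho>)
    show "KEC t = (1 / (norm (Uo t))\<^sup>2) *\<^sub>R
        ((C t - L t) ** outer (Uo t) (Uo t) - outer (Uo t) (Uo t) ** (C t - L t))"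
      by (simp add: KEC_t CEC)
  qed
  let ?u' = "\<lambda>\<alpha>. - (\<Sum>\<beta>\<in>UNIV. block K \<alpha> \<beta> *v blockv (Uo t) \<beta>)
      + (1/2) *\<^sub>R (\<Sum>\<beta>\<in>UNIV. block (BGo t) \<alpha> \<beta> *v blockv (Uo t) \<beta>) - blockv (QGo t) \<alpha>"
  have dU: "((\<lambda>s. blockv (Uo s) \<alpha>) has_vector_derivative ?u' \<alpha>) (at t)" for \<alpha>
  proof -
    have bl: "bounded_linear (\<lambda>W :: real^('n \<times> 'm). blockv W \<alpha>)"
      using linear_blockv by (simp add: linear_conv_bounded_linear)
    have "(Uo has_vector_derivative (- (K *v Uo t) + (1/2) *\<^sub>R (BGo t *v Uo t) - QGo t)) (at t)"
      using closed_system t rhs by metis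
    from bounded_linear.has_vector_derivative[OF bl this]
    show ?thesis by (simp only: blockv_arith blockv_mult)
  qed
  have P_t: "P t \<alpha> \<beta> = - (blockv (Uo t) \<alpha> \<bullet> (block K \<alpha> \<beta> *v blockv (Uo t) \<beta>))" for \<alpha> \<beta>
    by (simp add: P K_def)
  let ?b = "\<lambda>\<alpha>. \<Sum>\<beta>\<in>UNIV. blockv (Uo t) \<alpha> \<bullet> (block (BGo t) \<alpha> \<beta> *v blockv (Uo t) \<beta>)"
  have dE: "(E \<alpha> has_real_derivative
      ((\<Sum>\<beta>\<in>UNIV. P t \<alpha> \<beta>) + 1/2 * ?b \<alpha> - blockv (Uo t) \<alpha> \<bullet> blockv (QGo t) \<alpha>)) (at t)" for \<alpha>
  proof -
    have "blockv (Uo t) \<alpha> \<bullet> ?u' \<alpha>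
        = (\<Sum>\<beta>\<in>UNIV. P t \<alpha> \<beta>) + 1/2 * ?b \<alpha> - blockv (Uo t) \<alpha> \<bullet> blockv (QGo t) \<alpha>"
      by (simp add: P_t inner_diff_right inner_add_right inner_sum_right sum_negf)
    with half_norm_square_derivative[OF dU[of \<alpha>]] show ?thesis by (simp add: E)
  qed
  have P_skew: "P t \<alpha> \<beta> = - P t \<beta> \<alpha>" for \<alpha> \<beta>
    unfolding P_t by (subst block_skew_exchange[OF K_skew]) simp
  have P_sum: "(\<Sum>\<alpha>\<in>UNIV. \<Sum>\<beta>\<in>UNIV. P t \<alpha> \<beta>) = 0"
    using P_skew by (rule sum_antisymmetric)
  have "((\<lambda>s. \<Sum>\<alpha>\<in>UNIV. E \<alpha> s) has_real_derivative (\<Sum>\<alpha>\<in>UNIV. (\<Sum>\<beta>\<in>UNIV. P t \<alpha> \<beta>)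
      + 1/2 * ?b \<alpha> - blockv (Uo t) \<alpha> \<bullet> blockv (QGo t) \<alpha>)) (at t)"
    by (intro DERIV_sum dE)
  moreover have "(\<Sum>\<alpha>\<in>UNIV. (\<Sum>\<beta>\<in>UNIV. P t \<alpha> \<beta>) + 1/2 * ?b \<alpha> - blockv (Uo t) \<alpha> \<bullet> blockv (QGo t) \<alpha>)
      = 1/2 * (\<Sum>\<alpha>\<in>UNIV. ?b \<alpha>) - (\<Sum>\<alpha>\<in>UNIV. blockv (Uo t) \<alpha> \<bullet> blockv (QGo t) \<alpha>)"
    by (simp only: sum_subtractf sum.distrib P_sum flip: sum_distrib_left)
  ultimately have dTotal: "((\<lambda>s. \<Sum>\<alpha>\<in>UNIV. E \<alpha> s) has_real_derivative
      (1/2 * (\<Sum>\<alpha>\<in>UNIV. ?b \<alpha>) - (\<Sum>\<alpha>\<in>UNIV. blockv (Uo t) \<alpha> \<bullet> blockv (QGo t) \<alpha>))) (at t)"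
    by simp
  show "(\<forall>\<alpha>. ((\<lambda>s. blockv (Uo s) \<alpha>) has_vector_derivative
        (- (\<Sum>\<beta>\<in>UNIV. block (skw (No t) - skw (S t) - KEC t) \<alpha> \<beta> *v blockv (Uo t) \<beta>)
         + (1/2) *\<^sub>R (\<Sum>\<beta>\<in>UNIV. block (BGo t) \<alpha> \<beta> *v blockv (Uo t) \<beta>)
         - blockv (QGo t) \<alpha>)) (at t)) \<and>
    (\<forall>\<alpha>. (E \<alpha> has_real_derivative
        ((\<Sum>\<beta>\<in>UNIV. P t \<alpha> \<beta>)
         + 1/2 * (\<Sum>\<beta>\<in>UNIV. blockv (Uo t) \<alpha> \<bullet> (block (BGo t) \<alpha> \<beta> *v blockv (Uo t) \<beta>))
         - blockv (Uo t) \<alpha> \<bullet> blockv (QGo t) \<alpha>)) (at t)) \<and>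
    (\<forall>\<alpha> \<beta>. P t \<alpha> \<beta> = - P t \<beta> \<alpha>) \<and>
    (\<Sum>\<alpha>\<in>UNIV. \<Sum>\<beta>\<in>UNIV. P t \<alpha> \<beta>) = 0 \<and>
    ((\<lambda>s. \<Sum>\<alpha>\<in>UNIV. E \<alpha> s) has_real_derivative
        (1/2 * (\<Sum>\<alpha>\<in>UNIV. \<Sum>\<beta>\<in>UNIV.
            blockv (Uo t) \<alpha> \<bullet> (block (BGo t) \<alpha> \<beta> *v blockv (Uo t) \<beta>))
         - (\<Sum>\<alpha>\<in>UNIV. blockv (Uo t) \<alpha> \<bullet> blockv (QGo t) \<alpha>))) (at t)"
    unfolding K_def[symmetric] by (intro conjI allI dU dE P_skew P_sum dTotal)
qed

end
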